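(* Let $(G_n)_{n\ge 3}$ be one of the two families $G_n=\mathrm{SL}_n(\mathbb{Z})$ (for all $n\geq 3$) or $G_n=\mathrm{SAut}(F_n)$ (for all $n\ge 3$), with generating sets $\mathcal{S}_n$ and adjacent parts $\mathrm{Adj}_n=\mathrm{Adj}_n^++\mathrm{Adj}_n^-$ as defined in the context. Let $m\geq 3$ and let $\lambda$ be a real number. Suppose that $\mathrm{Adj}_m-\lambda I_{|\mathcal{S}_m|}$ is a sum of squares in $\mathbb{M}_{|\mathcal{S}_m|\times|\mathcal{S}_m|}(\mathbb{R}G_m)$. Then, for every $n\geq m$, the matrix $$\mathrm{Adj}_n-\frac{n-2}{m-2}\,\lambda\, I_{|\mathcal{S}_n|}$$ is a sum of squares in $\mathbb{M}_{|\mathcal{S}_n|\times|\mathcal{S}_n|}(\mathbb{R}G_n)$.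
   Context: **Sums of squares.** For a group $G$, the real group ring $\mathbb{R}G$ carries the linear involution $*$ given by $g\mapsto g^{-1}$; for a matrix $M$ over $\mathbb{R}G$, $M^*$ is the transpose of $M$ with $*$ applied to every entry. A matrix $M\in\mathbb{M}_{k\times k}(\mathbb{R}G)$ is a sum of squares if $M=M_1^*M_1+\dots+M_l^*M_l$ for some $M_1,\dots,M_l\in\mathbb{M}_{k\times k}(\mathbb{R}G)$. $I_k$ is the identity matrix. **Fox derivatives.** For a free group $F$ on a set $S$ and $s\in S$, the Fox derivative $\frac{\partial}{\partial s}$ is the additive endomorphism of $\mathbb{Z}F$ determined by $\frac{\partial 1}{\partial s}=0$, $\frac{\partial t}{\partial s}=\delta_{s,t}$ for $t\in S$, and $\frac{\partial (uv)}{\partial s}=\frac{\partial u}{\partial s}+u\frac{\partial v}{\partial s}$ for $u,v\in F$. When matrices over $\mathbb{R}G$ are formed, Fox derivatives are projected to the group ring of $G$ along the quotient map $F\to G$. **Generators and relators.** $[a,b]=aba^{-1}b^{-1}$. For $G_n=\mathrm{SL}_n(\mathbb{Z})$: $\mathcal{S}_n=\{E_{ij}: 1\le i\ne j\le n\}$ (elementary matrices with $1$ on the diagonal and at entry $(i,j)$, and $0$ elsewhere); the relators considered are $[E_{ij},E_{kl}]$ for all ordered pairs of generators with $i\ne l$, $j\neq k$, $(i,j)\ne(k,l)$, and $[E_{ij},E_{jk}]E_{ik}^{-1}$ for distinct $i,j,k$. For $G_n=\mathrm{SAut}(F_n)$, $F_n=\langle s_1,\dots,s_n\rangle$, with group operation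 $\alpha*\beta=\alpha\circ\beta$: $\mathcal{S}_n=\{\lambda_{ij},\rho_{ij}:1\le i\ne j\le n\}$, where $\lambda_{ij}(s_i)=s_js_i$, $\rho_{ij}(s_i)=s_is_j$, and both fix $s_k$ for $k\neq i$; the relators considered are, for all choices of distinct indices occurring in each expression, $[\lambda_{ij},\rho_{ij}]$, $[\lambda_{ij},\lambda_{kl}]$, $[\rho_{ij},\rho_{kl}]$, $[\lambda_{ij},\rho_{kl}]$, $[\lambda_{ij},\lambda_{kj}]$, $[\rho_{ij},\rho_{kj}]$, $[\lambda_{ij},\rho_{ik}]$, $[\lambda_{ij},\rho_{kj}]$, $\lambda_{ik}^{\pm}[\lambda_{jk}^{\pm},\lambda_{ij}^{-1}]$, $\rho_{ik}^{\pm}[\rho_{jk}^{\pm},\rho_{ij}^{-1}]$, $\lambda_{ik}^{\pm}[\rho_{jk}^{\mp},\lambda_{ij}]$, $\rho_{ik}^{\pm}[\lambda_{jk}^{\mp},\rho_{ij}]$ (the upper signs together, and the lower signs together). No other relators are considered. **Adjacent part.** For a word $w$ in the free group on $\mathcal{S}_n$, $\phi(w)\subseteq\{1,\dots,n\}$ is the set of all indices of the generators occurring in $w$. Matrices are indexed by $\mathcal{S}_n\times\mathcal{S}_n$. Define $$(\mathrm{Adj}_n^-)_{s,t}=\begin{cases}(1-s)(1-t)^*&\text{if } |\phi(s)\cup\phi(t)|=3,\\0&\text{otherwise,}\end{cases}\qquad (\mathrm{Adj}_n^+)_{s,t}=\sum_{r:\,|\phi(r)|=3}\Big(\frac{\partial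 r}{\partial s}\Big)^*\frac{\partial r}{\partial t},$$ where the sum is over those $r$ with $|\phi(r)|=3$ among the following relators of $G_n$: if $G_n=\mathrm{SL}_n(\mathbb{Z})$, the words $[E_{ij},E_{kl}]$ for all ordered pairs of generators with $i\ne l$, $j\neq k$, $(i,j)\ne(k,l)$, and $[E_{ij},E_{jk}]E_{ik}^{-1}$ for distinct $i,j,k$; if $G_n=\mathrm{SAut}(F_n)$, the words $[\lambda_{ij},\rho_{ij}]$, $[\lambda_{ij},\lambda_{kl}]$, $[\rho_{ij},\rho_{kl}]$, $[\lambda_{ij},\rho_{kl}]$, $[\lambda_{ij},\lambda_{kj}]$, $[\rho_{ij},\rho_{kj}]$, $[\lambda_{ij},\rho_{ik}]$, $[\lambda_{ij},\rho_{kj}]$, $\lambda_{ik}^{\pm}[\lambda_{jk}^{\pm},\lambda_{ij}^{-1}]$, $\rho_{ik}^{\pm}[\rho_{jk}^{\pm},\rho_{ij}^{-1}]$, $\lambda_{ik}^{\pm}[\rho_{jk}^{\mp},\lambda_{ij}]$, $\rho_{ik}^{\pm}[\lambda_{jk}^{\mp},\rho_{ij}]$ for all choices of distinct indices occurring in each expression (the upper signs together, and the lower signs together); and $\mathrm{Adj}_n=\mathrm{Adj}_n^++\mathrm{Adj}_n^-$. *)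

theory Defs
  imports
    "HOL-Algebra.Bij"
    "HOL-Library.Poly_Mapping"
    "Jordan_Normal_Form.Determinant"
begin

section \<open>Free groups\<close>

text \<open>The letter \<open>(s, True)\<close> stands for the generator \<open>s\<close> and \<open>(s, False)\<close> for its inverse.
  Elements of the free group are reduced words.\<close>

type_synonym 'a word = "('a \<times> bool) list"

definition cancels :: "'a \<times> bool \<Rightarrow> 'a \<times> bool \<Rightarrow> bool" where
  "cancels x y \<longleftrightarrow> fst x = fst y \<and> snd x \<noteq> snd y"

abbreviation reduced :: "'a word \<Rightarrow> bool" where
  "reduced \<equiv> successively (\<lambda>x y. \<not> cancels x y)"

fun red_cons :: "'a \<times> bool \<Rightarrow> 'a word \<Rightarrow> 'a word" where
  "red_cons x [] = [x]"
| "red_cons x (y # w) = (if cancels x y then w else x # y # w)"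

definition free_group :: "'a set \<Rightarrow> 'a word monoid" where
  "free_group S =
    \<lparr>carrier = {w. fst ` set w \<subseteq> S \<and> reduced w}, monoid.mult = foldr red_cons, one = []\<rparr>"

abbreviation gen :: "'a \<Rightarrow> 'a word" where
  "gen s \<equiv> [(s, True)]"

text \<open>The homomorphism from the free group to \<open>G\<close> that extends \<open>f\<close>.\<close>

definition free_lift :: "('g, 'b) monoid_scheme \<Rightarrow> ('a \<Rightarrow> 'g) \<Rightarrow> 'a word \<Rightarrow> 'g" where
  "free_lift G f w =
    foldr (\<lambda>(s, b) g. (if b then f s else inv\<^bsub>G\<^esub> f s) \<otimes>\<^bsub>G\<^esub> g) w \<one>\<^bsub>G\<^esub>"

definition commutator :: "('g, 'b) monoid_scheme \<Rightarrow> 'g \<Rightarrow> 'g \<Rightarrow> 'g" where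
  "commutator G a b = a \<otimes>\<^bsub>G\<^esub> b \<otimes>\<^bsub>G\<^esub> inv\<^bsub>G\<^esub> a \<otimes>\<^bsub>G\<^esub> inv\<^bsub>G\<^esub> b"

lemma reduced_Cons:
  "reduced (x # w) \<longleftrightarrow> reduced w \<and> (\<forall>y v. w = y # v \<longrightarrow> \<not> cancels x y)"
  by (cases w) auto

lemma red_cons_reduced: "reduced (x # w) \<Longrightarrow> red_cons x w = x # w"
  by (cases w) auto

lemma reduced_red_cons: "reduced w \<Longrightarrow> reduced (red_cons x w)"
  by (cases w) (auto simp: reduced_Cons)

lemma set_red_cons: "set (red_cons x w) \<subseteq> insert x (set w)"
  by (cases w) auto

lemma red_cons_cancel:
  assumes "reduced w" "cancels x y"
  shows "red_cons x (red_cons y w) = w"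
proof (cases w)
  case Nil
  then show ?thesis using assms by simp
next
  case (Cons z v)
  show ?thesis
  proof (cases "cancels y z")
    case True
    then have "x = z" using assms by (auto simp: cancels_def prod_eq_iff)
    then show ?thesis using True Cons assms by (auto simp: red_cons_reduced)
  qed (use Cons assms in auto)
qed

lemma reduced_foldr: "reduced w \<Longrightarrow> reduced (foldr red_cons u w)"
  by (induction u) (auto simp: reduced_red_cons)

lemma set_foldr: "set (foldr red_cons u w) \<subseteq> set u \<union> set w"
proof (induction u)
  case (Cons x u)
  then show ?case using set_red_cons[of x "foldr red_cons u w"] by auto
qed simp

lemma foldr_red_cons:
  assumes "reduced v" "reduced w"
  shows "foldr red_cons (red_cons x v) w = red_cons x (foldr red_cons v w)"
proof (cases v)
  case (Cons y v')
  then show ?thesis using assms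
    by (auto simp: red_cons_cancel reduced_foldr reduced_Cons)
qed simp

lemma foldr_assoc:
  assumes "reduced v" "reduced w"
  shows "foldr red_cons (foldr red_cons u v) w = foldr red_cons u (foldr red_cons v w)"
  using assms by (induction u) (auto simp: foldr_red_cons reduced_foldr)

lemma foldr_reduced: "reduced u \<Longrightarrow> foldr red_cons u [] = u"
  by (induction u) (auto simp: red_cons_reduced reduced_Cons)

definition inv_word :: "'a word \<Rightarrow> 'a word" where
  "inv_word w = rev (map (\<lambda>(s, b). (s, \<not> b)) w)"

lemma reduced_inv_word: "reduced w \<Longrightarrow> reduced (inv_word w)"
  unfolding inv_word_def
  by (auto simp: successively_map cancels_def case_prod_unfold elim!: successively_mono)

lemma inv_word_left: "reduced w \<Longrightarrow> foldr red_cons (inv_word w) w = []"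
proof (induction w)
  case Nil
  then show ?case by (simp add: inv_word_def)
next
  case (Cons x w)
  have "red_cons (fst x, \<not> snd x) (x # w) = w" by (simp add: cancels_def)
  then show ?case using Cons
    by (simp add: inv_word_def reduced_Cons case_prod_unfold)
qed

lemma group_free_group: "group (free_group S)"
proof (rule groupI)
  fix u v assume "u \<in> carrier (free_group S)" "v \<in> carrier (free_group S)"
  then show "u \<otimes>\<^bsub>free_group S\<^esub> v \<in> carrier (free_group S)"
    using set_foldr[of u v] by (fastforce simp: free_group_def reduced_foldr)
next
  fix u assume u: "u \<in> carrier (free_group S)"
  have "fst ` set (inv_word u) = fst ` set u"
    by (force simp: inv_word_def image_iff)
  then show "\<exists>v\<in>carrier (free_group S). v \<otimes>\<^bsub>free_group S\<^esub> u = \<one>\<^bsub>free_group S\<^esub>"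
    using u by (intro bexI[of _ "inv_word u"])
      (auto simp: free_group_def reduced_inv_word inv_word_left)
qed (auto simp: free_group_def foldr_assoc)


lemma free_lift_hom:
  fixes G (structure)
  assumes "group G" "f \<in> S \<rightarrow> carrier G"
  shows "free_lift G f \<in> hom (free_group S) G" "s \<in> S \<Longrightarrow> free_lift G f (gen s) = f s"
proof -
  interpret group G by fact
  let ?h = "free_lift G f"
  have step: "?h (x # w) = (if snd x then f (fst x) else inv f (fst x)) \<otimes> ?h w" for x w
    by (simp add: free_lift_def case_prod_unfold)
  have closed: "?h w \<in> carrier G" if "fst ` set w \<subseteq> S" for w
    using that assms(2) by (induction w) (auto simp: step Pi_iff, simp add: free_lift_def)
  have red: "?h (red_cons x w) = ?h (x # w)" if "fst x \<in> S" "fst ` set w \<subseteq> S" for x w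
  proof (cases w)
    case (Cons y v)
    then have "f (fst x) \<in> carrier G" "f (fst y) \<in> carrier G" "?h v \<in> carrier G"
      using that assms(2) closed[of v] by auto
    then show ?thesis
      using \<open>w = y # v\<close> by (auto simp: step cancels_def m_assoc[symmetric])
  qed simp
  have "?h (foldr red_cons u v) = ?h u \<otimes> ?h v" if "fst ` set u \<subseteq> S" "fst ` set v \<subseteq> S" for u v
    using that(1)
  proof (induction u)
    case Nil
    then show ?case using closed[OF that(2)] by (simp add: free_lift_def)
  next
    case (Cons x u)
    have "fst ` set (foldr red_cons u v) \<subseteq> S" using set_foldr[of u v] Cons.prems that(2) by fastforce
    moreover have "f (fst x) \<in> carrier G" using Cons.prems assms(2) by auto
    ultimately show ?case
      using Cons closed[of u] closed[of v] that(2) by (simp add: red step m_assoc)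
  qed
  then show "?h \<in> hom (free_group S) G"
    using closed by (auto simp: hom_def free_group_def)
  show "?h (gen s) = f s" if "s \<in> S"
    using that funcset_mem[OF assms(2)] by (simp add: free_lift_def)
qed


section \<open>Group rings\<close>

text \<open>The group ring of \<open>G\<close> consists of the finitely supported functions with support in the
  carrier of \<open>G\<close>; its addition is that of the type of finitely supported functions.\<close>

definition gring :: "('g, 'b) monoid_scheme \<Rightarrow> ('g \<Rightarrow>\<^sub>0 'r::comm_ring_1) set" where
  "gring G = {a. Poly_Mapping.keys a \<subseteq> carrier G}"

abbreviation gr_of :: "'g \<Rightarrow> 'g \<Rightarrow>\<^sub>0 'r::comm_ring_1" where
  "gr_of g \<equiv> Poly_Mapping.single g 1"

abbreviation gr_one :: "('g, 'b) monoid_scheme \<Rightarrow> 'g \<Rightarrow>\<^sub>0 'r::comm_ring_1" where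
  "gr_one G \<equiv> gr_of \<one>\<^bsub>G\<^esub>"

definition gr_mult ::
  "('g, 'b) monoid_scheme \<Rightarrow> ('g \<Rightarrow>\<^sub>0 'r::comm_ring_1) \<Rightarrow> ('g \<Rightarrow>\<^sub>0 'r) \<Rightarrow> 'g \<Rightarrow>\<^sub>0 'r" where
  "gr_mult G a b =
    (\<Sum>g\<in>Poly_Mapping.keys a. \<Sum>h\<in>Poly_Mapping.keys b.
      Poly_Mapping.single (g \<otimes>\<^bsub>G\<^esub> h) (Poly_Mapping.lookup a g * Poly_Mapping.lookup b h))"

definition gr_star ::
  "('g, 'b) monoid_scheme \<Rightarrow> ('g \<Rightarrow>\<^sub>0 'r::comm_ring_1) \<Rightarrow> 'g \<Rightarrow>\<^sub>0 'r" where
  "gr_star G a =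
    (\<Sum>g\<in>Poly_Mapping.keys a. Poly_Mapping.single (inv\<^bsub>G\<^esub> g) (Poly_Mapping.lookup a g))"

text \<open>The map from the integral group ring of \<open>F\<close> to the real group ring of \<open>G\<close> induced by a
  homomorphism \<open>\<pi>\<close> from \<open>F\<close> to \<open>G\<close>.\<close>

definition gr_proj :: "('f \<Rightarrow> 'g) \<Rightarrow> ('f \<Rightarrow>\<^sub>0 int) \<Rightarrow> 'g \<Rightarrow>\<^sub>0 real" where
  "gr_proj \<pi> a =
    (\<Sum>w\<in>Poly_Mapping.keys a. Poly_Mapping.single (\<pi> w) (of_int (Poly_Mapping.lookup a w)))"


section \<open>Sums of squares\<close>

text \<open>A matrix with index set \<open>S\<close> over the group ring is a function of two arguments, of which
  only the values on \<open>S \<times> S\<close> matter.\<close>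

type_synonym ('s, 'g) gr_mat = "'s \<Rightarrow> 's \<Rightarrow> 'g \<Rightarrow>\<^sub>0 real"

definition gr_mats :: "('g, 'b) monoid_scheme \<Rightarrow> 's set \<Rightarrow> ('s, 'g) gr_mat set" where
  "gr_mats G S = {M. \<forall>s\<in>S. \<forall>t\<in>S. M s t \<in> gring G}"

definition gr_mat_mult ::
  "('g, 'b) monoid_scheme \<Rightarrow> 's set \<Rightarrow> ('s, 'g) gr_mat \<Rightarrow> ('s, 'g) gr_mat \<Rightarrow> ('s, 'g) gr_mat" where
  "gr_mat_mult G S M N = (\<lambda>s t. \<Sum>u\<in>S. gr_mult G (M s u) (N u t))"

definition gr_mat_star ::
  "('g, 'b) monoid_scheme \<Rightarrow> ('s, 'g) gr_mat \<Rightarrow> ('s, 'g) gr_mat" where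
  "gr_mat_star G M = (\<lambda>s t. gr_star G (M t s))"

definition scalar_mat :: "('g, 'b) monoid_scheme \<Rightarrow> real \<Rightarrow> ('s, 'g) gr_mat" where
  "scalar_mat G c = (\<lambda>s t. if s = t then Poly_Mapping.single \<one>\<^bsub>G\<^esub> c else 0)"

definition sum_of_squares ::
  "('g, 'b) monoid_scheme \<Rightarrow> 's set \<Rightarrow> ('s, 'g) gr_mat \<Rightarrow> bool" where
  "sum_of_squares G S M \<longleftrightarrow>
    (\<exists>Ns. set Ns \<subseteq> gr_mats G S \<and>
      (\<forall>s\<in>S. \<forall>t\<in>S. M s t = (\<Sum>N\<leftarrow>Ns. gr_mat_mult G S (gr_mat_star G N) N s t)))"


section \<open>Fox derivatives\<close>

text \<open>On a word the product rule forces
  \<open>\<partial>(x w) = \<partial>x + x \<cdot> \<partial>w\<close> and \<open>\<partial>(s\<^sup>-\<^sup>1) = - s\<^sup>-\<^sup>1\<close> for a letter \<open>x\<close> and a generator \<open>s\<close>.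
  That the resulting map is the Fox derivative is \<open>fox_derivative\<close> and
  \<open>fox_unique\<close> below.\<close>

primrec fox_word :: "'a \<Rightarrow> 'a word \<Rightarrow> 'a word \<Rightarrow>\<^sub>0 int" where
  "fox_word s [] = 0"
| "fox_word s (x # w) =
    (if fst x = s then if snd x then frag_of [] else - frag_of [x] else 0)
      + frag_extend (\<lambda>v. frag_of (red_cons x v)) (fox_word s w)"

definition fox :: "'a \<Rightarrow> ('a word \<Rightarrow>\<^sub>0 int) \<Rightarrow> 'a word \<Rightarrow>\<^sub>0 int" where
  "fox s = frag_extend (fox_word s)"

definition is_fox :: "'a set \<Rightarrow> 'a \<Rightarrow> (('a word \<Rightarrow>\<^sub>0 int) \<Rightarrow> 'a word \<Rightarrow>\<^sub>0 int) \<Rightarrow> bool" where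
  "is_fox S s D \<longleftrightarrow>
    D \<in> gring (free_group S) \<rightarrow> gring (free_group S) \<and>
    (\<forall>a\<in>gring (free_group S). \<forall>b\<in>gring (free_group S). D (a + b) = D a + D b) \<and>
    D (gr_one (free_group S)) = 0 \<and>
    (\<forall>t\<in>S. D (gr_of (gen t)) = (if s = t then gr_one (free_group S) else 0)) \<and>
    (\<forall>u\<in>carrier (free_group S). \<forall>v\<in>carrier (free_group S).
      D (gr_of (u \<otimes>\<^bsub>free_group S\<^esub> v))
        = D (gr_of u) + gr_mult (free_group S) (gr_of u) (D (gr_of v)))"


lemma gr_mult_gr_of:
  "gr_mult G (gr_of g) (b :: 'g \<Rightarrow>\<^sub>0 int) = frag_extend (\<lambda>h. frag_of (g \<otimes>\<^bsub>G\<^esub> h)) b"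
proof -
  have "frag_cmul c (frag_of x) = Poly_Mapping.single x c" for x :: 'g and c
    by (rule poly_mapping_eqI) (simp add: lookup_single when_def)
  then show ?thesis by (simp add: gr_mult_def frag_extend_def)
qed

lemma keys_frag_extend_of:
  "Poly_Mapping.keys (frag_extend (\<lambda>v. frag_of (f v)) a) \<subseteq> f ` Poly_Mapping.keys a"
  using keys_frag_extend[of "\<lambda>v. frag_of (f v)" a] by auto

lemma keys_fox_word:
  "Poly_Mapping.keys (fox_word s w) \<subseteq> {v. fst ` set v \<subseteq> fst ` set w \<and> reduced v}"
proof (induction w)
  case (Cons x w)
  let ?a = "if fst x = s then if snd x then frag_of [] else - frag_of [x] else 0"
  let ?b = "frag_extend (\<lambda>v. frag_of (red_cons x v)) (fox_word s w)"
  show ?case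
  proof
    fix v assume "v \<in> Poly_Mapping.keys (fox_word s (x # w))"
    moreover have "Poly_Mapping.keys (fox_word s (x # w)) \<subseteq> Poly_Mapping.keys ?a \<union> Poly_Mapping.keys ?b"
      unfolding fox_word.simps by (rule keys_add)
    ultimately consider "v = []" | "v = [x]" | "v \<in> Poly_Mapping.keys ?b"
      by (auto split: if_splits)
    then show "v \<in> {v. fst ` set v \<subseteq> fst ` set (x # w) \<and> reduced v}"
    proof cases
      case 3
      then obtain u where u: "v = red_cons x u" "u \<in> Poly_Mapping.keys (fox_word s w)"
        using keys_frag_extend_of[of "red_cons x"] by blast
      then have "fst ` set u \<subseteq> fst ` set w" "reduced u" using Cons by auto
      then show ?thesis using u(1) set_red_cons[of x u] by (auto simp: reduced_red_cons)
    qed auto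
  qed
qed simp

lemma fox_word_red_cons:
  assumes "reduced w"
  shows "fox_word s (red_cons x w) = fox_word s (x # w)"
proof (cases "\<exists>y v. w = y # v \<and> cancels x y")
  case False
  then have "red_cons x w = x # w" by (cases w) auto
  then show ?thesis by simp
next
  case True
  then obtain y v where w: "w = y # v" "cancels x y" by auto
  then obtain t b where xy: "x = (t, b)" "y = (t, \<not> b)"
    by (cases x; cases y) (auto simp: cancels_def)
  let ?L = "\<lambda>x. frag_extend (\<lambda>v. frag_of (red_cons x v))"
  have "?L x (?L y (fox_word s v)) = frag_extend (\<lambda>u. frag_of (red_cons x (red_cons y u))) (fox_word s v)"
    using frag_extend_compose[of "\<lambda>v. frag_of (red_cons x v)" "red_cons y" "fox_word s v"]
    by (simp add: o_def)
  also have "\<dots> = frag_extend frag_of (fox_word s v)"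
  proof (rule frag_extend_eq)
    fix u assume "u \<in> Poly_Mapping.keys (fox_word s v)"
    then have "reduced u" using keys_fox_word[of s v] by blast
    then show "frag_of (red_cons x (red_cons y u)) = frag_of u"
      using w(2) by (simp only: red_cons_cancel)
  qed
  also have "\<dots> = fox_word s v" by (rule frag_expansion[symmetric])
  finally have "?L x (?L y (fox_word s v)) = fox_word s v" .
  then show ?thesis
    using w by (cases b; cases "t = s") (simp_all add: xy frag_extend_add frag_extend_diff frag_extend_minus cancels_def)
qed

lemma fox_word_mult:
  assumes "reduced v"
  shows "fox_word s (foldr red_cons u v)
    = fox_word s u + frag_extend (\<lambda>w. frag_of (foldr red_cons u w)) (fox_word s v)"
proof (induction u)
  case Nil
  then show ?case by (simp add: frag_expansion[symmetric])
next
  case (Cons x u)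
  then show ?case
    using frag_extend_compose[of "\<lambda>v. frag_of (red_cons x v)" "foldr red_cons u" "fox_word s v"]
    by (simp add: fox_word_red_cons reduced_foldr assms frag_extend_add o_def)
qed

lemma fox_derivative: "is_fox S s (fox s)"
proof -
  have closed: "fox s a \<in> gring (free_group S)" if "a \<in> gring (free_group S)" for a
  proof -
    have "Poly_Mapping.keys (fox s a) \<subseteq> (\<Union>w\<in>Poly_Mapping.keys a. Poly_Mapping.keys (fox_word s w))"
      unfolding fox_def by (rule keys_frag_extend)
    also have "\<dots> \<subseteq> carrier (free_group S)"
      using keys_fox_word[of s] that by (fastforce simp: free_group_def gring_def)
    finally show ?thesis by (simp add: gring_def)
  qed
  have prod: "fox s (gr_of (u \<otimes>\<^bsub>free_group S\<^esub> v))
      = fox s (gr_of u) + gr_mult (free_group S) (gr_of u) (fox s (gr_of v))"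
    if "v \<in> carrier (free_group S)" for u v
    using that by (simp add: gr_mult_gr_of) (simp add: fox_def free_group_def fox_word_mult)
  have one: "fox s (gr_one (free_group S)) = 0"
    by (simp add: fox_def free_group_def)
  have gen: "fox s (gr_of (gen t)) = (if s = t then gr_one (free_group S) else 0)" for t
    by (simp add: fox_def free_group_def)
  have add: "fox s (a + b) = fox s a + fox s b" for a b
    by (simp add: fox_def frag_extend_add)
  show ?thesis
    unfolding is_fox_def by (intro conjI ballI Pi_I closed one gen add prod)
qed

lemma is_foxD:
  assumes "is_fox S s D"
  shows "D (gr_one (free_group S)) = 0"
    and "\<forall>t\<in>S. D (gr_of (gen t)) = (if s = t then gr_one (free_group S) else 0)"
    and "\<forall>a\<in>gring (free_group S). \<forall>b\<in>gring (free_group S). D (a + b) = D a + D b"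
    and "\<forall>u\<in>carrier (free_group S). \<forall>v\<in>carrier (free_group S).
      D (gr_of (u \<otimes>\<^bsub>free_group S\<^esub> v))
        = D (gr_of u) + gr_mult (free_group S) (gr_of u) (D (gr_of v))"
  using assms unfolding is_fox_def by - (elim conjE, assumption)+

lemma fox_unique:
  assumes "is_fox S s D" "is_fox S s D'" "a \<in> gring (free_group S)"
  shows "D a = D' a"
proof -
  let ?F = "free_group S"
  note one = is_foxD(1) and gen = is_foxD(2)[rule_format]
    and add = is_foxD(3)[rule_format] and mult = is_foxD(4)[rule_format]
  have letter: "D (gr_of [x]) = D' (gr_of [x])" if x: "fst x \<in> S" for x
  proof (cases "snd x")
    case True
    then have "[x] = gen (fst x)" by (cases x) simp
    then show ?thesis using gen[OF assms(1) x] gen[OF assms(2) x] by simp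
  next
    case False
    let ?t = "gen (fst x)"
    have t: "[x] \<in> carrier ?F" "?t \<in> carrier ?F" "[x] \<otimes>\<^bsub>?F\<^esub> ?t = \<one>\<^bsub>?F\<^esub>"
      using x False by (auto simp: free_group_def cancels_def)
    have "E (gr_of [x]) = - gr_mult ?F (gr_of [x]) (E (gr_of ?t))" if "is_fox S s E" for E
      using mult[OF that t(1,2)] one[OF that] unfolding t(3) by (simp add: eq_neg_iff_add_eq_0)
    from this[OF assms(1)] this[OF assms(2)] show ?thesis
      using gen[OF assms(1) x] gen[OF assms(2) x] by simp
  qed
  have word: "D (gr_of w) = D' (gr_of w)" if "w \<in> carrier ?F" for w
    using that
  proof (induction w)
    case Nil
    have "\<one>\<^bsub>?F\<^esub> = []" by (simp add: free_group_def)
    then show ?case using one[OF assms(1)] one[OF assms(2)] by simp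
  next
    case (Cons x w)
    then have x: "[x] \<in> carrier ?F" "w \<in> carrier ?F" "fst x \<in> S" "[x] \<otimes>\<^bsub>?F\<^esub> w = x # w"
      by (auto simp: free_group_def reduced_Cons red_cons_reduced)
    have "E (gr_of (x # w)) = E (gr_of [x]) + gr_mult ?F (gr_of [x]) (E (gr_of w))"
      if "is_fox S s E" for E
      using mult[OF that x(1,2)] unfolding x(4) .
    from this[OF assms(1)] this[OF assms(2)] show ?case
      using Cons.IH[OF x(2)] letter[OF x(3)] by simp
  qed
  have minus: "E (b - c) = E b - E c"
    if "is_fox S s E" "b \<in> gring ?F" "c \<in> gring ?F" for E b c
  proof -
    have "b - c \<in> gring ?F" using that keys_diff[of b c] by (auto simp: gring_def)
    from add[OF that(1) this that(3)] show ?thesis by simp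
  qed
  have "Poly_Mapping.keys a \<subseteq> carrier ?F" using assms by (simp add: gring_def)
  then have "a \<in> gring ?F \<and> D a = D' a"
  proof (induction a rule: frag_induction)
    case zero
    have "(0 :: 'a word \<Rightarrow>\<^sub>0 int) \<in> gring ?F" by (simp add: gring_def)
    then show ?case using minus[OF assms(1), of 0 0] minus[OF assms(2), of 0 0] by simp
  next
    case (one w)
    then show ?case using word by (simp add: gring_def)
  next
    case (diff b c)
    then have "b - c \<in> gring ?F" using keys_diff[of b c] by (auto simp: gring_def)
    then show ?case using diff minus[OF assms(1), of b c] minus[OF assms(2), of b c] by simp
  qed
  then show ?thesis by simp
qed


section \<open>The adjacent part\<close>

text \<open>Generators are formal symbols, so that their indices can be read off: \<open>ev\<close> sends a symbol to
  the element of \<open>G\<close> it denotes, \<open>ix\<close> sends it to its set of indices, and \<open>R\<close> is a finite set of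
  relators.\<close>

definition word_ix :: "('s \<Rightarrow> nat set) \<Rightarrow> 's word \<Rightarrow> nat set" where
  "word_ix ix w = (\<Union>x\<in>set w. ix (fst x))"

definition fox_mat ::
  "('g, 'b) monoid_scheme \<Rightarrow> ('s \<Rightarrow> 'g) \<Rightarrow> 's word \<Rightarrow> 's \<Rightarrow> 'g \<Rightarrow>\<^sub>0 real" where
  "fox_mat G ev r s = gr_proj (free_lift G ev) (fox s (gr_of r))"

definition adj_minus ::
  "('g, 'b) monoid_scheme \<Rightarrow> ('s \<Rightarrow> 'g) \<Rightarrow> ('s \<Rightarrow> nat set) \<Rightarrow> ('s, 'g) gr_mat" where
  "adj_minus G ev ix = (\<lambda>s t.
    if card (ix s \<union> ix t) = 3
    then gr_mult G (gr_one G - gr_of (ev s)) (gr_star G (gr_one G - gr_of (ev t)))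
    else 0)"

definition adj_plus ::
  "('g, 'b) monoid_scheme \<Rightarrow> ('s \<Rightarrow> 'g) \<Rightarrow> ('s \<Rightarrow> nat set) \<Rightarrow> 's word set \<Rightarrow> ('s, 'g) gr_mat" where
  "adj_plus G ev ix R = (\<lambda>s t.
    \<Sum>r | r \<in> R \<and> card (word_ix ix r) = 3.
      gr_mult G (gr_star G (fox_mat G ev r s)) (fox_mat G ev r t))"

definition adj ::
  "('g, 'b) monoid_scheme \<Rightarrow> ('s \<Rightarrow> 'g) \<Rightarrow> ('s \<Rightarrow> nat set) \<Rightarrow> 's word set \<Rightarrow> ('s, 'g) gr_mat" where
  "adj G ev ix R = (\<lambda>s t. adj_plus G ev ix R s t + adj_minus G ev ix s t)"


section \<open>The special linear groups\<close>

text \<open>Here and below the indices run through \<open>{..<n}\<close> instead of \<open>{1..n}\<close>.\<close>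

definition SL :: "nat \<Rightarrow> int mat monoid" where
  "SL n = \<lparr>carrier = {A \<in> carrier_mat n n. det A = 1}, monoid.mult = (*), one = 1\<^sub>m n\<rparr>"

datatype sl_gen = Elem nat nat

definition sl_gens :: "nat \<Rightarrow> sl_gen set" where
  "sl_gens n = {Elem i j | i j. i < n \<and> j < n \<and> i \<noteq> j}"

fun sl_ix :: "sl_gen \<Rightarrow> nat set" where
  "sl_ix (Elem i j) = {i, j}"

fun sl_ev :: "nat \<Rightarrow> sl_gen \<Rightarrow> int mat" where
  "sl_ev n (Elem i j) = addrow_mat n 1 i j"

definition sl_rels :: "nat \<Rightarrow> sl_gen word set" where
  "sl_rels n = (let F = free_group (sl_gens n); E = (\<lambda>i j. gen (Elem i j)) in
    {commutator F (E i j) (E k l) | i j k l.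
      {i, j, k, l} \<subseteq> {..<n} \<and> i \<noteq> j \<and> k \<noteq> l \<and> i \<noteq> l \<and> j \<noteq> k \<and> (i, j) \<noteq> (k, l)} \<union>
    {commutator F (E i j) (E j k) \<otimes>\<^bsub>F\<^esub> inv\<^bsub>F\<^esub> E i k | i j k.
      {i, j, k} \<subseteq> {..<n} \<and> distinct [i, j, k]})"

definition sl_adj :: "nat \<Rightarrow> (sl_gen, int mat) gr_mat" where
  "sl_adj n = adj (SL n) (sl_ev n) sl_ix (sl_rels n)"

lemma group_SL: "group (SL n)"
proof (rule groupI)
  fix A assume A: "A \<in> carrier (SL n)"
  then have A': "A \<in> carrier_mat n n" "det A = 1" by (auto simp: SL_def)
  have B: "adj_mat A \<in> carrier_mat n n" "adj_mat A * A = 1\<^sub>m n"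
    using adj_mat[OF A'(1)] A'(2) by auto
  then have "det (adj_mat A) * det A = 1" using A' by (metis det_mult det_one)
  then show "\<exists>B\<in>carrier (SL n). B \<otimes>\<^bsub>SL n\<^esub> A = \<one>\<^bsub>SL n\<^esub>"
    using A' B by (intro bexI[of _ "adj_mat A"]) (auto simp: SL_def)
qed (auto simp: SL_def det_mult)

lemma sl_ev_carrier: "s \<in> sl_gens n \<Longrightarrow> sl_ev n s \<in> carrier (SL n)"
  by (auto simp: sl_gens_def SL_def det_addrow_mat)

lemma finite_image_indices:
  fixes n :: nat
  shows "finite {f2 i j | i j. {i, j} \<subseteq> {..<n} \<and> P2 i j}"
    and "finite {f3 i j k | i j k. {i, j, k} \<subseteq> {..<n} \<and> P3 i j k}"
    and "finite {f4 i j k l | i j k l. {i, j, k, l} \<subseteq> {..<n} \<and> P4 i j k l}"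
    and "finite {f5 i j k e | i j k (e :: int). {i, j, k} \<subseteq> {..<n} \<and> P5 i j k \<and> e \<in> {1, -1}}"
proof -
  show "finite {f2 i j | i j. {i, j} \<subseteq> {..<n} \<and> P2 i j}"
    by (rule finite_subset[of _ "\<Union>i<n. \<Union>j<n. {f2 i j}"]) auto
  show "finite {f3 i j k | i j k. {i, j, k} \<subseteq> {..<n} \<and> P3 i j k}"
    by (rule finite_subset[of _ "\<Union>i<n. \<Union>j<n. \<Union>k<n. {f3 i j k}"]) auto
  show "finite {f4 i j k l | i j k l. {i, j, k, l} \<subseteq> {..<n} \<and> P4 i j k l}"
    by (rule finite_subset[of _ "\<Union>i<n. \<Union>j<n. \<Union>k<n. \<Union>l<n. {f4 i j k l}"]) auto
  show "finite {f5 i j k e | i j k (e :: int). {i, j, k} \<subseteq> {..<n} \<and> P5 i j k \<and> e \<in> {1, -1}}"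
    by (rule finite_subset[of _ "\<Union>i<n. \<Union>j<n. \<Union>k<n. \<Union>e\<in>{1, -1}. {f5 i j k e}"]) auto
qed

lemma finite_sl_rels: "finite (sl_rels n)"
  unfolding sl_rels_def Let_def by (intro finite_UnI finite_image_indices)

lemma inj_sl_ev: "inj_on (sl_ev n) (sl_gens n)"
proof (rule inj_onI)
  fix s t assume "s \<in> sl_gens n" "t \<in> sl_gens n" and eq: "sl_ev n s = sl_ev n t"
  then obtain i j k l where st: "s = Elem i j" "t = Elem k l" "i < n" "j < n" "i \<noteq> j" "k \<noteq> l"
    by (auto simp: sl_gens_def)
  have "addrow_mat n 1 i j $$ (i, j) = (addrow_mat n 1 k l $$ (i, j) :: int)"
    using eq st by simp
  then show "s = t" using st by (auto split: if_splits)
qed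


section \<open>The special automorphism groups of free groups\<close>

text \<open>The \<open>j\<close>-th column of \<open>ab_mat n \<alpha>\<close> is the image of \<open>\<alpha> s\<^sub>j\<close> in the abelianization, and \<open>SAut n\<close>
  is the preimage of the special linear group under \<open>ab_mat n\<close>. Its operation is composition,
  \<open>\<alpha> * \<beta> = \<alpha> \<circ> \<beta>\<close>, on automorphisms restricted to the free group.\<close>

definition exp_sum :: "'a \<Rightarrow> 'a word \<Rightarrow> int" where
  "exp_sum s w = (\<Sum>x\<leftarrow>w. if fst x = s then if snd x then 1 else -1 else 0)"

definition ab_mat :: "nat \<Rightarrow> (nat word \<Rightarrow> nat word) \<Rightarrow> int mat" where
  "ab_mat n \<alpha> = mat n n (\<lambda>(i, j). exp_sum i (\<alpha> (gen j)))"

definition SAut :: "nat \<Rightarrow> (nat word \<Rightarrow> nat word) monoid" where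
  "SAut n = (AutoGroup (free_group {..<n}))
    \<lparr>carrier := {\<alpha> \<in> auto (free_group {..<n}). det (ab_mat n \<alpha>) = 1}\<rparr>"

datatype saut_gen = Lam nat nat | Rho nat nat

definition saut_gens :: "nat \<Rightarrow> saut_gen set" where
  "saut_gens n = (\<Union>i<n. \<Union>j\<in>{..<n} - {i}. {Lam i j, Rho i j})"

fun saut_ix :: "saut_gen \<Rightarrow> nat set" where
  "saut_ix (Lam i j) = {i, j}"
| "saut_ix (Rho i j) = {i, j}"

fun saut_ev :: "nat \<Rightarrow> saut_gen \<Rightarrow> nat word \<Rightarrow> nat word" where
  "saut_ev n (Lam i j) = (let F = free_group {..<n} in
    restrict (free_lift F (\<lambda>k. if k = i then gen j \<otimes>\<^bsub>F\<^esub> gen i else gen k)) (carrier F))"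
| "saut_ev n (Rho i j) = (let F = free_group {..<n} in
    restrict (free_lift F (\<lambda>k. if k = i then gen i \<otimes>\<^bsub>F\<^esub> gen j else gen k)) (carrier F))"

text \<open>The exponent \<open>e\<close> encodes the signs \<open>\<plusminus>\<close>.\<close>

definition saut_rels :: "nat \<Rightarrow> saut_gen word set" where
  "saut_rels n = (let F = free_group (saut_gens n);
      L = (\<lambda>i j. gen (Lam i j)); R = (\<lambda>i j. gen (Rho i j)); I = {..<n} in
    {commutator F (L i j) (R i j) | i j. {i, j} \<subseteq> I \<and> distinct [i, j]} \<union>
    {commutator F (L i j) (L k l) | i j k l. {i, j, k, l} \<subseteq> I \<and> distinct [i, j, k, l]} \<union>
    {commutator F (R i j) (R k l) | i j k l. {i, j, k, l} \<subseteq> I \<and> distinct [i, j, k, l]} \<union>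
    {commutator F (L i j) (R k l) | i j k l. {i, j, k, l} \<subseteq> I \<and> distinct [i, j, k, l]} \<union>
    {commutator F (L i j) (L k j) | i j k. {i, j, k} \<subseteq> I \<and> distinct [i, j, k]} \<union>
    {commutator F (R i j) (R k j) | i j k. {i, j, k} \<subseteq> I \<and> distinct [i, j, k]} \<union>
    {commutator F (L i j) (R i k) | i j k. {i, j, k} \<subseteq> I \<and> distinct [i, j, k]} \<union>
    {commutator F (L i j) (R k j) | i j k. {i, j, k} \<subseteq> I \<and> distinct [i, j, k]} \<union>
    {L i k [^]\<^bsub>F\<^esub> e \<otimes>\<^bsub>F\<^esub> commutator F (L j k [^]\<^bsub>F\<^esub> e) (inv\<^bsub>F\<^esub> L i j) | i j k (e :: int).
      {i, j, k} \<subseteq> I \<and> distinct [i, j, k] \<and> e \<in> {1, -1}} \<union>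
    {R i k [^]\<^bsub>F\<^esub> e \<otimes>\<^bsub>F\<^esub> commutator F (R j k [^]\<^bsub>F\<^esub> e) (inv\<^bsub>F\<^esub> R i j) | i j k (e :: int).
      {i, j, k} \<subseteq> I \<and> distinct [i, j, k] \<and> e \<in> {1, -1}} \<union>
    {L i k [^]\<^bsub>F\<^esub> e \<otimes>\<^bsub>F\<^esub> commutator F (R j k [^]\<^bsub>F\<^esub> (- e)) (L i j) | i j k (e :: int).
      {i, j, k} \<subseteq> I \<and> distinct [i, j, k] \<and> e \<in> {1, -1}} \<union>
    {R i k [^]\<^bsub>F\<^esub> e \<otimes>\<^bsub>F\<^esub> commutator F (L j k [^]\<^bsub>F\<^esub> (- e)) (R i j) | i j k (e :: int).
      {i, j, k} \<subseteq> I \<and> distinct [i, j, k] \<and> e \<in> {1, -1}})"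

definition saut_adj :: "nat \<Rightarrow> (saut_gen, nat word \<Rightarrow> nat word) gr_mat" where
  "saut_adj n = adj (SAut n) (saut_ev n) saut_ix (saut_rels n)"


lemma exp_sum_Cons:
  "exp_sum s (x # w) = (if fst x = s then if snd x then 1 else -1 else 0) + exp_sum s w"
  by (simp add: exp_sum_def)

lemma exp_sum_mult: "exp_sum s (foldr red_cons u v) = exp_sum s u + exp_sum s v"
proof (induction u)
  case (Cons x u)
  have "exp_sum s (red_cons x w) = exp_sum s (x # w)" for w
    by (cases w) (auto simp: exp_sum_Cons cancels_def)
  then show ?case using Cons by (simp add: exp_sum_Cons)
qed (simp add: exp_sum_def)

lemma exp_sum_hom:
  fixes n :: nat
  defines "F \<equiv> free_group {..<n}"
  assumes h: "h \<in> hom F F" and w: "w \<in> carrier F"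
  shows "exp_sum i (h w) = (\<Sum>k<n. exp_sum i (h (gen k)) * exp_sum k w)"
proof -
  interpret h: group_hom F F h
    using h by (simp add: F_def group_hom_def group_hom_axioms_def group_free_group)
  have mult: "u \<otimes>\<^bsub>F\<^esub> v = foldr red_cons u v" and one: "\<one>\<^bsub>F\<^esub> = []" for u v
    by (simp_all add: F_def free_group_def)
  have letter: "exp_sum i (h [x]) = (\<Sum>k<n. exp_sum i (h (gen k)) * exp_sum k [x])" if "fst x < n" for x
  proof -
    have c: "[x] \<in> carrier F" "gen (fst x) \<in> carrier F"
      using that by (auto simp: F_def free_group_def)
    have "exp_sum i (h [x]) = (if snd x then 1 else -1) * exp_sum i (h (gen (fst x)))"
    proof (cases "snd x")
      case True
      then have "[x] = gen (fst x)" by (cases x) simp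
      then show ?thesis using True by simp
    next
      case False
      then have "[x] \<otimes>\<^bsub>F\<^esub> gen (fst x) = \<one>\<^bsub>F\<^esub>" by (simp add: mult one cancels_def)
      then have "foldr red_cons (h [x]) (h (gen (fst x))) = []"
        using h.hom_mult[OF c] h.hom_one by (simp only: mult one)
      then have "exp_sum i (h [x]) + exp_sum i (h (gen (fst x))) = exp_sum i []"
        by (simp only: exp_sum_mult[symmetric])
      then show ?thesis using False by (simp add: exp_sum_def)
    qed
    also have "\<dots> = (\<Sum>k<n. if k = fst x then exp_sum i (h (gen k)) * (if snd x then 1 else -1) else 0)"
      using that by (simp add: mult.commute)
    also have "\<dots> = (\<Sum>k<n. exp_sum i (h (gen k)) * exp_sum k [x])"
      by (rule sum.cong) (auto simp: exp_sum_def)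
    finally show ?thesis .
  qed
  show ?thesis
    using w
  proof (induction w)
    case Nil
    have "exp_sum j [] = 0" for j :: nat by (simp add: exp_sum_def)
    then show ?case using h.hom_one by (simp add: one)
  next
    case (Cons x w)
    then have x: "[x] \<in> carrier F" "w \<in> carrier F" "fst x < n" "[x] \<otimes>\<^bsub>F\<^esub> w = x # w"
      by (auto simp: F_def free_group_def reduced_Cons red_cons_reduced)
    have "h (x # w) = h [x] \<otimes>\<^bsub>F\<^esub> h w"
      using h.hom_mult[OF x(1,2)] unfolding x(4) .
    also have "\<dots> = foldr red_cons (h [x]) (h w)" by (rule mult)
    finally have "exp_sum i (h (x # w)) = exp_sum i (h [x]) + exp_sum i (h w)"
      by (simp only: exp_sum_mult)
    moreover have "exp_sum k (x # w) = exp_sum k [x] + exp_sum k w" for k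
      by (simp add: exp_sum_def)
    ultimately show ?case
      using Cons.IH[OF x(2)] letter[OF x(3)] by (simp add: sum.distrib distrib_left)
  qed
qed

lemma ab_mat_compose:
  fixes n :: nat
  defines "F \<equiv> free_group {..<n}"
  assumes "\<alpha> \<in> hom F F" "\<beta> \<in> hom F F"
  shows "ab_mat n (compose (carrier F) \<alpha> \<beta>) = ab_mat n \<alpha> * ab_mat n \<beta>"
proof (rule eq_matI)
  fix i j assume "i < dim_row (ab_mat n \<alpha> * ab_mat n \<beta>)" "j < dim_col (ab_mat n \<alpha> * ab_mat n \<beta>)"
  then have ij: "i < n" "j < n" by (simp_all add: ab_mat_def)
  then have g: "gen j \<in> carrier F" by (auto simp: F_def free_group_def)
  then have "\<beta> (gen j) \<in> carrier F" using assms(3) by (auto simp: hom_def)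
  then show "ab_mat n (compose (carrier F) \<alpha> \<beta>) $$ (i, j) = (ab_mat n \<alpha> * ab_mat n \<beta>) $$ (i, j)"
    using ij g exp_sum_hom[of \<alpha> n "\<beta> (gen j)" i] assms(2)
    by (simp add: F_def ab_mat_def scalar_prod_def compose_eq atLeast0LessThan)
qed (simp_all add: ab_mat_def)

lemma ab_mat_id: "ab_mat n (restrict (\<lambda>w. w) (carrier (free_group {..<n}))) = 1\<^sub>m n"
  by (rule eq_matI) (auto simp: ab_mat_def free_group_def exp_sum_def)

lemma subgroup_SAut: "subgroup (carrier (SAut n)) (AutoGroup (free_group {..<n}))"
proof -
  let ?F = "free_group {..<n}"
  interpret F: group ?F by (rule group_free_group)
  interpret A: group "AutoGroup ?F" by (rule F.AutoGroup)
  have carr: "carrier (AutoGroup ?F) = auto ?F" by (simp add: AutoGroup_def)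
  have mult: "\<alpha> \<otimes>\<^bsub>AutoGroup ?F\<^esub> \<beta> = compose (carrier ?F) \<alpha> \<beta>" if "\<alpha> \<in> auto ?F" "\<beta> \<in> auto ?F" for \<alpha> \<beta>
    using that by (simp add: AutoGroup_def BijGroup_def auto_def)
  have one: "\<one>\<^bsub>AutoGroup ?F\<^esub> = restrict (\<lambda>w. w) (carrier ?F)"
    by (simp add: AutoGroup_def BijGroup_def)
  have det: "det (ab_mat n (\<alpha> \<otimes>\<^bsub>AutoGroup ?F\<^esub> \<beta>)) = det (ab_mat n \<alpha>) * det (ab_mat n \<beta>)"
    if "\<alpha> \<in> auto ?F" "\<beta> \<in> auto ?F" for \<alpha> \<beta>
    using that ab_mat_compose[of \<alpha> n \<beta>]
    by (simp add: mult auto_def det_mult[of _ n] ab_mat_def)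
  have one_det: "det (ab_mat n \<one>\<^bsub>AutoGroup ?F\<^esub>) = 1" by (simp add: one ab_mat_id)
  have "det (ab_mat n (inv\<^bsub>AutoGroup ?F\<^esub> \<alpha>)) = 1" if "\<alpha> \<in> auto ?F" "det (ab_mat n \<alpha>) = 1" for \<alpha>
    using det[of \<alpha> "inv\<^bsub>AutoGroup ?F\<^esub> \<alpha>"] that one_det A.inv_closed[of \<alpha>] A.r_inv[of \<alpha>] by (simp add: carr)
  then show ?thesis
    using det one_det A.one_closed A.m_closed A.inv_closed
    by (intro subgroup.intro) (auto simp: SAut_def carr)
qed

lemma group_SAut: "group (SAut n)"
proof -
  have "SAut n = (AutoGroup (free_group {..<n}))\<lparr>carrier := carrier (SAut n)\<rparr>"
    by (simp add: SAut_def)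
  then show ?thesis
    using subgroup.subgroup_is_group[OF subgroup_SAut group.AutoGroup[OF group_free_group]] by metis
qed


lemma finite_saut_rels: "finite (saut_rels n)"
  unfolding saut_rels_def Let_def by (intro finite_UnI finite_image_indices)

end

theory Submission
  imports Defs
begin

text \<open>The matrix \<open>Adj\<^sub>n\<close> is assembled from pieces that involve three indices each: the relators
  \<open>r\<close> with \<open>\<bar>\<phi>(r)\<bar> = 3\<close> and the pairs of generators \<open>s, t\<close> with \<open>\<bar>\<phi>(s) \<union> \<phi>(t)\<bar> = 3\<close>.
  The proof goes from \<open>n\<close> to \<open>n + 1\<close> by averaging over the index that is left out.

  For \<open>p \<le> n\<close> let \<open>insert_index p\<close> be the increasing injection of \<open>{..<n}\<close> into \<open>{..<Suc n}\<close> that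
  skips \<open>p\<close>. It renames the generators of \<open>G\<^sub>n\<close> to the generators of \<open>G\<^sub>n\<^sub>+\<^sub>1\<close> without the index
  \<open>p\<close>, and the relators likewise, and the renaming of generators comes from a group homomorphism
  \<open>G\<^sub>n \<rightarrow> G\<^sub>n\<^sub>+\<^sub>1\<close>. Fox derivatives are natural under such a renaming (\<open>fox_mat_relabel\<close>), so the
  image of \<open>Adj\<^sub>n\<close>, extended by zero to the generators with index \<open>p\<close>, consists of exactly those
  pieces of \<open>Adj\<^sub>n\<^sub>+\<^sub>1\<close> that avoid \<open>p\<close>. A piece with three indices avoids \<open>p\<close> for \<open>n - 2\<close> of the
  \<open>n + 1\<close> values of \<open>p\<close>, whereas a single generator, which has two indices, avoids it for \<open>n - 1\<close>
  of them. Summing the images of \<open>Adj\<^sub>n - c I\<close> over \<open>p\<close> therefore gives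
  \<open>(n - 2) Adj\<^sub>n\<^sub>+\<^sub>1 - (n - 1) c I\<close> (\<open>sum_push_adj\<close>, \<open>sum_push_scalar\<close>). Homomorphic images,
  sums and nonnegative multiples of sums of squares are sums of squares, so
  \<open>Adj\<^sub>n\<^sub>+\<^sub>1 - (n - 1) / (n - 2) \<cdot> c I\<close> is one whenever \<open>Adj\<^sub>n - c I\<close> is. From \<open>m\<close> on, the factors
  \<open>(n - 1) / (n - 2)\<close> telescope to \<open>(n - 2) / (m - 2)\<close>.

  The locale \<open>index_family\<close> states what this argument asks of a family of groups. For \<open>SL\<^sub>n(\<int>)\<close>
  the homomorphism adds a row and a column of the identity matrix at \<open>p\<close>. For \<open>SAut(F\<^sub>n)\<close> it
  renames the free generators and lets the automorphism fix the new one; on the abelianization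
  this is the embedding of matrices again, so the determinant stays \<open>1\<close>.\<close>


section \<open>Functoriality of group rings\<close>

definition gr_map :: "('g \<Rightarrow> 'h) \<Rightarrow> ('g \<Rightarrow>\<^sub>0 'r::comm_ring_1) \<Rightarrow> 'h \<Rightarrow>\<^sub>0 'r" where
  "gr_map h a = (\<Sum>g\<in>Poly_Mapping.keys a. Poly_Mapping.single (h g) (Poly_Mapping.lookup a g))"

definition gr_scale :: "'r \<Rightarrow> ('g \<Rightarrow>\<^sub>0 'r::comm_ring_1) \<Rightarrow> 'g \<Rightarrow>\<^sub>0 'r" where
  "gr_scale c = Poly_Mapping.map ((*) c)"

text \<open>Identities between maps that are additive in a group ring element need only be checked on
  multiples of single group elements. The set \<open>S\<close> keeps the elements in the carrier, where
  homomorphisms are multiplicative.\<close>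

lemma gr_induct [consumes 1, case_names zero single add]:
  fixes a :: "'g \<Rightarrow>\<^sub>0 'r::comm_ring_1"
  assumes "Poly_Mapping.keys a \<subseteq> S" and zero: "P 0"
    and single: "\<And>g c. g \<in> S \<Longrightarrow> P (Poly_Mapping.single g c)"
    and add: "\<And>a b. P a \<Longrightarrow> P b \<Longrightarrow> P (a + b)"
  shows "P a"
proof -
  have a: "a = (\<Sum>g\<in>Poly_Mapping.keys a. Poly_Mapping.single g (Poly_Mapping.lookup a g))"
    by (rule poly_mapping_eqI) (auto simp: lookup_sum lookup_single when_def in_keys_iff)
  have "P (\<Sum>g\<in>A. Poly_Mapping.single g (Poly_Mapping.lookup a g))"
    if "finite A" "A \<subseteq> S" for A
    using that by (induction A) (auto intro: zero single add)
  then show ?thesis using assms(1) a finite_keys[of a] by metis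
qed

lemma gr_map_add: "gr_map h (a + b) = gr_map h a + gr_map h b"
  unfolding gr_map_def by (rule setsum_keys_plus_distrib) (auto simp: single_add)

lemma gr_map_single [simp]: "gr_map h (Poly_Mapping.single g c) = Poly_Mapping.single (h g) c"
  by (simp add: gr_map_def)

lemma gr_map_zero [simp]: "gr_map h 0 = 0"
  by (simp add: gr_map_def)

lemma gr_map_diff: "gr_map h (a - b) = gr_map h a - gr_map h b"
  using gr_map_add[of h "a - b" b] by simp

lemma gr_map_sum: "gr_map h (\<Sum>i\<in>A. f i) = (\<Sum>i\<in>A. gr_map h (f i))"
  by (induction A rule: infinite_finite_induct) (auto simp: gr_map_add)

lemma keys_gr_map: "Poly_Mapping.keys (gr_map h a) \<subseteq> h ` Poly_Mapping.keys a"
  unfolding gr_map_def by (rule order_trans[OF keys_sum]) auto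

lemma gr_star_add: "gr_star G (a + b) = gr_star G a + gr_star G b"
  unfolding gr_star_def by (rule setsum_keys_plus_distrib) (auto simp: single_add)

lemma gr_star_single [simp]:
  "gr_star G (Poly_Mapping.single g c) = Poly_Mapping.single (inv\<^bsub>G\<^esub> g) c"
  by (simp add: gr_star_def)

lemma gr_star_zero [simp]: "gr_star G 0 = 0"
  by (simp add: gr_star_def)

lemma gr_mult_add_left: "gr_mult G (a + b) d = gr_mult G a d + gr_mult G b d"
  unfolding gr_mult_def
  by (rule setsum_keys_plus_distrib) (simp_all add: distrib_right single_add sum.distrib)

lemma gr_mult_add_right: "gr_mult G d (a + b) = gr_mult G d a + gr_mult G d b"
proof -
  have swap: "gr_mult G d c = (\<Sum>h\<in>Poly_Mapping.keys c. \<Sum>g\<in>Poly_Mapping.keys d.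
      Poly_Mapping.single (g \<otimes>\<^bsub>G\<^esub> h) (Poly_Mapping.lookup d g * Poly_Mapping.lookup c h))" for c
    unfolding gr_mult_def by (rule sum.swap)
  show ?thesis
    unfolding swap
    by (rule setsum_keys_plus_distrib) (simp_all add: distrib_left single_add sum.distrib)
qed

lemma gr_mult_zero [simp]: "gr_mult G 0 a = 0" "gr_mult G a 0 = 0"
  by (simp_all add: gr_mult_def)

lemma gr_mult_single [simp]:
  "gr_mult G (Poly_Mapping.single g c) (Poly_Mapping.single h d)
    = Poly_Mapping.single (g \<otimes>\<^bsub>G\<^esub> h) (c * d)"
  by (simp add: gr_mult_def)

lemma gringD: "a \<in> gring G \<Longrightarrow> Poly_Mapping.keys a \<subseteq> carrier G"
  by (simp add: gring_def)

lemma gring_zero [simp]: "0 \<in> gring G"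
  by (simp add: gring_def)

lemma gring_add: "a \<in> gring G \<Longrightarrow> b \<in> gring G \<Longrightarrow> a + b \<in> gring G"
  using keys_add[of a b] by (auto simp: gring_def)

lemma gring_single: "g \<in> carrier G \<Longrightarrow> Poly_Mapping.single g c \<in> gring G"
  by (simp add: gring_def)

lemma gring_diff: "a \<in> gring G \<Longrightarrow> b \<in> gring G \<Longrightarrow> (a - b :: 'g \<Rightarrow>\<^sub>0 'r::comm_ring_1) \<in> gring G"
  using keys_diff[of a b] by (auto simp: gring_def)

lemma gring_star:
  assumes "group G" "a \<in> gring G"
  shows "gr_star G a \<in> gring G"
  using gringD[OF assms(2)]
  by (induction rule: gr_induct)
    (auto simp: gr_star_add intro!: gring_add gring_single group.inv_closed assms(1))

lemma gring_map:
  assumes "h \<in> carrier G \<rightarrow> carrier H" "a \<in> gring G"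
  shows "gr_map h a \<in> gring H"
  using assms keys_gr_map[of h a] by (fastforce simp: gring_def)

lemma gr_map_mult:
  assumes "h \<in> hom G H" "a \<in> gring G" "b \<in> gring G"
  shows "gr_map h (gr_mult G a b) = gr_mult H (gr_map h a) (gr_map h b)"
  using gringD[OF assms(2)]
proof (induction rule: gr_induct)
  case (single g c)
  show ?case
    using gringD[OF assms(3)]
    by (induction rule: gr_induct)
      (auto simp: single hom_mult[OF assms(1)] gr_mult_add_right gr_map_add)
qed (auto simp: gr_mult_add_left gr_map_add)

lemma gr_map_star:
  assumes "group G" "group H" "h \<in> hom G H" "a \<in> gring G"
  shows "gr_map h (gr_star G a) = gr_star H (gr_map h a)"
proof -
  interpret group_hom G H h
    using assms by (simp add: group_hom_def group_hom_axioms_def)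
  show ?thesis
    using gringD[OF assms(4)]
    by (induction rule: gr_induct) (auto simp: gr_star_add gr_map_add)
qed

lemma lookup_gr_scale [simp]: "Poly_Mapping.lookup (gr_scale c a) g = c * Poly_Mapping.lookup a g"
  by (simp add: gr_scale_def Poly_Mapping.map.rep_eq when_def)

lemma gr_scale_single [simp]:
  "gr_scale c (Poly_Mapping.single g d) = Poly_Mapping.single g (c * d)"
  by (rule poly_mapping_eqI) (simp add: lookup_single when_def)

lemma gr_scale_zero [simp]: "gr_scale c 0 = 0"
  by (rule poly_mapping_eqI) simp

lemma gr_scale_add: "gr_scale c (a + b) = gr_scale c a + gr_scale c b"
  by (rule poly_mapping_eqI) (simp add: lookup_add distrib_left)

lemma gr_scale_diff: "gr_scale c (a - b) = gr_scale c a - gr_scale c b"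
  by (rule poly_mapping_eqI) (simp add: lookup_minus right_diff_distrib)

lemma gr_scale_sum: "gr_scale c (\<Sum>i\<in>A. f i) = (\<Sum>i\<in>A. gr_scale c (f i))"
  by (rule poly_mapping_eqI) (simp add: lookup_sum sum_distrib_left)

lemma gr_scale_scale: "gr_scale c (gr_scale d a) = gr_scale (c * d) a"
  by (rule poly_mapping_eqI) (simp add: mult.assoc)

lemma gr_scale_one [simp]: "gr_scale 1 a = a"
  by (rule poly_mapping_eqI) simp

lemma gr_sum_const: "(\<Sum>i\<in>A. a) = gr_scale (of_nat (card A)) a"
  by (rule poly_mapping_eqI) (simp add: lookup_sum)

lemma gr_mult_scale: "gr_mult G (gr_scale c a) (gr_scale d b) = gr_scale (c * d) (gr_mult G a b)"
proof (induction a rule: gr_induct[OF subset_UNIV, consumes 0])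
  case (2 g e)
  show ?case
    by (induction b rule: gr_induct[OF subset_UNIV, consumes 0])
      (auto simp: gr_mult_add_right gr_scale_add ac_simps)
qed (auto simp: gr_mult_add_left gr_scale_add)

lemma gr_star_scale: "gr_star G (gr_scale c a) = gr_scale c (gr_star G a)"
  by (induction a rule: gr_induct[OF subset_UNIV, consumes 0])
    (auto simp: gr_star_add gr_scale_add)


section \<open>Closure properties of sums of squares\<close>

lemma sum_of_squares_cong:
  assumes "\<And>s t. s \<in> S \<Longrightarrow> t \<in> S \<Longrightarrow> M s t = M' s t"
  shows "sum_of_squares G S M \<longleftrightarrow> sum_of_squares G S M'"
  using assms by (simp add: sum_of_squares_def)

lemma sum_of_squares_add:
  assumes "sum_of_squares G S M" "sum_of_squares G S M'"
  shows "sum_of_squares G S (\<lambda>s t. M s t + M' s t)"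
proof -
  obtain Ns Ns' where
    "set Ns \<subseteq> gr_mats G S" "set Ns' \<subseteq> gr_mats G S"
    "\<forall>s\<in>S. \<forall>t\<in>S. M s t = (\<Sum>N\<leftarrow>Ns. gr_mat_mult G S (gr_mat_star G N) N s t)"
    "\<forall>s\<in>S. \<forall>t\<in>S. M' s t = (\<Sum>N\<leftarrow>Ns'. gr_mat_mult G S (gr_mat_star G N) N s t)"
    using assms unfolding sum_of_squares_def by blast
  then show ?thesis
    unfolding sum_of_squares_def by (intro exI[of _ "Ns @ Ns'"]) simp
qed

lemma sum_of_squares_sum:
  assumes "\<And>p. p \<in> A \<Longrightarrow> sum_of_squares G S (M p)"
  shows "sum_of_squares G S (\<lambda>s t. \<Sum>p\<in>A. M p s t)"
proof -
  have zero: "sum_of_squares G S (\<lambda>s t. 0)"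
    unfolding sum_of_squares_def by (intro exI[of _ "[]"]) simp
  show ?thesis
    using assms
    by (induction A rule: infinite_finite_induct) (auto simp: zero intro: sum_of_squares_add)
qed

text \<open>The square root of the scalar can be absorbed into each factor.\<close>

lemma sum_of_squares_scale:
  fixes M :: "('s, 'g) gr_mat"
  assumes "c \<ge> 0" "sum_of_squares G S M"
  shows "sum_of_squares G S (\<lambda>s t. gr_scale c (M s t))"
proof -
  obtain Ns where Ns: "set Ns \<subseteq> gr_mats G S"
    "\<forall>s\<in>S. \<forall>t\<in>S. M s t = (\<Sum>N\<leftarrow>Ns. gr_mat_mult G S (gr_mat_star G N) N s t)"
    using assms(2) unfolding sum_of_squares_def by blast
  let ?f = "\<lambda>N :: ('s, 'g) gr_mat. (\<lambda>s t. gr_scale (sqrt c) (N s t))"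
  have "gr_mat_mult G S (gr_mat_star G (?f N)) (?f N) s t
      = gr_scale c (gr_mat_mult G S (gr_mat_star G N) N s t)" for N s t
    using assms(1)
    by (simp add: gr_mat_mult_def gr_mat_star_def gr_star_scale gr_mult_scale gr_scale_sum)
  then have "(\<Sum>N\<leftarrow>map ?f Ns. gr_mat_mult G S (gr_mat_star G N) N s t)
      = gr_scale c (\<Sum>N\<leftarrow>Ns. gr_mat_mult G S (gr_mat_star G N) N s t)" for s t
    by (induction Ns) (auto simp: gr_scale_add)
  moreover have "set (map ?f Ns) \<subseteq> gr_mats G S"
  proof -
    have "?f N \<in> gr_mats G S" if "N \<in> gr_mats G S" for N
      using that by (auto simp: gr_mats_def gring_def in_keys_iff subset_iff)
    then show ?thesis using Ns(1) by auto
  qed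
  ultimately show ?thesis
    unfolding sum_of_squares_def using Ns(2) by (intro exI[of _ "map ?f Ns"]) simp
qed

definition push_mat :: "('g \<Rightarrow> 'h) \<Rightarrow> ('s \<Rightarrow> 't) \<Rightarrow> 's set \<Rightarrow> ('s, 'g) gr_mat \<Rightarrow> ('t, 'h) gr_mat" where
  "push_mat h f S M = (\<lambda>u v. if u \<in> f ` S \<and> v \<in> f ` S
    then gr_map h (M (inv_into S f u) (inv_into S f v)) else 0)"

lemma push_mat_apply:
  assumes "inj_on f S" "s \<in> S" "t \<in> S"
  shows "push_mat h f S M (f s) (f t) = gr_map h (M s t)"
  using assms by (simp add: push_mat_def)

lemma push_mat_outside:
  "u \<notin> f ` S \<or> v \<notin> f ` S \<Longrightarrow> push_mat h f S M u v = 0"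
  by (auto simp: push_mat_def)

text \<open>Because \<open>push_mat\<close> extends by zero, the rows outside \<open>f ` S\<close> add nothing to the product, and
  what remains is the product over \<open>S\<close>, transported by \<open>h\<close>.\<close>

lemma push_mat_square:
  assumes "group G" "group H" "h \<in> hom G H" "inj_on f S" "f ` S \<subseteq> T" "finite T"
    "N \<in> gr_mats G S"
  shows "gr_mat_mult H T (gr_mat_star H (push_mat h f S N)) (push_mat h f S N) u v
    = push_mat h f S (gr_mat_mult G S (gr_mat_star G N) N) u v"
proof (cases "u \<in> f ` S \<and> v \<in> f ` S")
  case False
  then show ?thesis by (auto simp: gr_mat_mult_def gr_mat_star_def push_mat_outside)
next
  case True
  then obtain s t where st: "u = f s" "v = f t" "s \<in> S" "t \<in> S" by auto
  let ?P = "push_mat h f S N"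
  have "gr_mat_mult H T (gr_mat_star H ?P) ?P u v
      = (\<Sum>w\<in>T. gr_mult H (gr_star H (?P w u)) (?P w v))"
    by (simp add: gr_mat_mult_def gr_mat_star_def)
  also have "\<dots> = (\<Sum>w\<in>f ` S. gr_mult H (gr_star H (?P w u)) (?P w v))"
    using assms(5,6) by (intro sum.mono_neutral_right) (auto simp: push_mat_outside)
  also have "\<dots> = (\<Sum>w\<in>S. gr_mult H (gr_star H (gr_map h (N w s))) (gr_map h (N w t)))"
    unfolding sum.reindex[OF assms(4)] by (rule sum.cong) (simp_all add: st push_mat_apply[OF assms(4)])
  also have "\<dots> = (\<Sum>w\<in>S. gr_map h (gr_mult G (gr_star G (N w s)) (N w t)))"
  proof (rule sum.cong)
    fix w assume "w \<in> S"
    then have "N w s \<in> gring G" "N w t \<in> gring G"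
      using assms(7) st by (auto simp: gr_mats_def)
    then show "gr_mult H (gr_star H (gr_map h (N w s))) (gr_map h (N w t))
        = gr_map h (gr_mult G (gr_star G (N w s)) (N w t))"
      using assms by (simp add: gr_map_mult gring_star gr_map_star)
  qed simp
  also have "\<dots> = push_mat h f S (gr_mat_mult G S (gr_mat_star G N) N) u v"
    using st assms(4) by (simp add: push_mat_apply gr_mat_mult_def gr_mat_star_def gr_map_sum)
  finally show ?thesis .
qed

lemma sum_of_squares_push:
  assumes "group G" "group H" "h \<in> hom G H" "inj_on f S" "f ` S \<subseteq> T" "finite T"
    "sum_of_squares G S M"
  shows "sum_of_squares H T (push_mat h f S M)"
proof -
  obtain Ns where Ns: "set Ns \<subseteq> gr_mats G S"
    "\<forall>s\<in>S. \<forall>t\<in>S. M s t = (\<Sum>N\<leftarrow>Ns. gr_mat_mult G S (gr_mat_star G N) N s t)"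
    using assms(7) unfolding sum_of_squares_def by blast
  let ?P = "push_mat h f S"
  have "?P M u v = ?P (\<lambda>s t. \<Sum>N\<leftarrow>Ns. gr_mat_mult G S (gr_mat_star G N) N s t) u v" for u v
    using Ns(2) by (auto simp: push_mat_def inv_into_into)
  also have "\<dots> u v = (\<Sum>N\<leftarrow>Ns. ?P (gr_mat_mult G S (gr_mat_star G N) N) u v)" for u v
    by (induction Ns) (auto simp: push_mat_def gr_map_add)
  also have "\<dots> u v = (\<Sum>N\<leftarrow>Ns. gr_mat_mult H T (gr_mat_star H (?P N)) (?P N) u v)" for u v
    using Ns(1)
    by (intro arg_cong[where f = sum_list] map_cong) (auto simp: push_mat_square[OF assms(1-6)])
  finally have "?P M u v = (\<Sum>N\<leftarrow>map ?P Ns. gr_mat_mult H T (gr_mat_star H N) N u v)" for u v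
    by (simp add: o_def)
  moreover have "set (map ?P Ns) \<subseteq> gr_mats H T"
  proof -
    have "h \<in> carrier G \<rightarrow> carrier H" using assms(3) by (auto simp: hom_def)
    then have "?P N \<in> gr_mats H T" if "N \<in> gr_mats G S" for N
      using that by (auto simp: gr_mats_def push_mat_def inv_into_into intro!: gring_map[of h G])
    then show ?thesis using Ns(1) by auto
  qed
  ultimately show ?thesis unfolding sum_of_squares_def by blast
qed


section \<open>Naturality of Fox derivatives\<close>

abbreviation relabel :: "('s \<Rightarrow> 't) \<Rightarrow> 's word \<Rightarrow> 't word" where
  "relabel f \<equiv> map (apfst f)"

lemma red_cons_relabel:
  "inj f \<Longrightarrow> red_cons (apfst f x) (relabel f w) = relabel f (red_cons x w)"
  by (cases w) (auto simp: cancels_def inj_eq)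

text \<open>An injective renaming creates no new cancellations, so it commutes with the reduction of words
  and thereby with the recursion for the Fox derivative.\<close>

lemma fox_word_relabel:
  assumes "inj f"
  shows "fox_word (f s) (relabel f w) = frag_extend (\<lambda>v. frag_of (relabel f v)) (fox_word s w)"
proof (induction w)
  case (Cons x w)
  let ?L = "\<lambda>f. frag_extend (\<lambda>v. frag_of (f v))"
  have "?L (red_cons (apfst f x)) (?L (relabel f) (fox_word s w))
      = ?L (\<lambda>v. red_cons (apfst f x) (relabel f v)) (fox_word s w)"
    using frag_extend_compose[of "\<lambda>v. frag_of (red_cons (apfst f x) v)" "relabel f"]
    by (simp add: o_def)
  also have "\<dots> = ?L (relabel f) (?L (red_cons x) (fox_word s w))"
    using frag_extend_compose[of "\<lambda>v. frag_of (relabel f v)" "red_cons x"]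
    by (simp add: o_def red_cons_relabel[OF assms])
  finally show ?case
    using Cons by (auto simp: frag_extend_add frag_extend_minus inj_eq[OF assms])
qed simp

lemma gr_proj_add: "gr_proj \<pi> (a + b) = gr_proj \<pi> a + gr_proj \<pi> b"
  unfolding gr_proj_def by (rule setsum_keys_plus_distrib) (auto simp: single_add)

lemma gr_proj_diff: "gr_proj \<pi> (a - b) = gr_proj \<pi> a - gr_proj \<pi> b"
  using gr_proj_add[of \<pi> "a - b" b] by simp

lemma gr_proj_push:
  assumes "Poly_Mapping.keys a \<subseteq> W" "\<And>w. w \<in> W \<Longrightarrow> \<pi>' (f w) = h (\<pi> w)"
  shows "gr_proj \<pi>' (frag_extend (\<lambda>v. frag_of (f v)) a) = gr_map h (gr_proj \<pi> a)"
  using assms(1)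
proof (induction a rule: frag_induction)
  case (one w)
  then show ?case using assms(2) by (simp add: gr_proj_def)
qed (simp add: gr_proj_def, simp add: frag_extend_diff gr_proj_diff gr_map_diff)

lemma free_lift_closed:
  assumes "group G" "ev \<in> S \<rightarrow> carrier G" "fst ` set w \<subseteq> S"
  shows "free_lift G ev w \<in> carrier G"
proof -
  interpret group G by fact
  show ?thesis
    using assms(3)
  proof (induction w)
    case (Cons x w)
    then have "ev (fst x) \<in> carrier G" using assms(2) by auto
    then show ?case using Cons by (auto simp: free_lift_def case_prod_unfold)
  qed (simp add: free_lift_def)
qed

lemma free_lift_relabel:
  assumes "group G" "group H" "h \<in> hom G H"
    and "ev \<in> S \<rightarrow> carrier G" "\<And>s. s \<in> S \<Longrightarrow> ev' (f s) = h (ev s)" "fst ` set w \<subseteq> S"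
  shows "free_lift H ev' (relabel f w) = h (free_lift G ev w)"
proof -
  interpret group_hom G H h
    using assms by (simp add: group_hom_def group_hom_axioms_def)
  show ?thesis
    using assms(6)
  proof (induction w)
    case (Cons x w)
    then have "fst x \<in> S" "ev (fst x) \<in> carrier G" "free_lift G ev w \<in> carrier G"
      using assms(4) free_lift_closed[OF assms(1,4), of w] by auto
    then show ?case using Cons assms(5)
      by (auto simp: free_lift_def case_prod_unfold)
  qed (simp add: free_lift_def)
qed

lemma fox_mat_eq: "fox_mat G ev r s = gr_proj (free_lift G ev) (fox_word s r)"
  by (simp add: fox_mat_def fox_def)

text \<open>If a homomorphism \<open>h\<close> sends the element denoted by \<open>s\<close> to the element denoted by \<open>f s\<close>, then
  the projections to the two groups intertwine renaming of words with \<open>h\<close>, and naturality of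
  the Fox derivative passes from the free groups to the group rings.\<close>

lemma fox_mat_relabel:
  assumes "group G" "group H" "h \<in> hom G H" "inj f"
    and "ev \<in> S \<rightarrow> carrier G" "\<And>s. s \<in> S \<Longrightarrow> ev' (f s) = h (ev s)" "fst ` set r \<subseteq> S"
  shows "fox_mat H ev' (relabel f r) (f s) = gr_map h (fox_mat G ev r s)"
  unfolding fox_mat_eq fox_word_relabel[OF assms(4)]
proof (rule gr_proj_push)
  show "Poly_Mapping.keys (fox_word s r) \<subseteq> {v. fst ` set v \<subseteq> S}"
    using keys_fox_word[of s r] assms(7) by auto
qed (use free_lift_relabel[where ev = ev and ev' = ev' and f = f, OF assms(1-3,5)] assms(6) in auto)

lemma fox_mat_gring:
  assumes "group G" "ev \<in> S \<rightarrow> carrier G" "fst ` set r \<subseteq> S"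
  shows "fox_mat G ev r s \<in> gring G"
proof -
  have "free_lift G ev w \<in> carrier G" if "w \<in> Poly_Mapping.keys (fox_word s r)" for w
    using free_lift_closed[OF assms(1,2), of w] keys_fox_word[of s r] that assms(3) by auto
  moreover have "Poly_Mapping.keys (fox_mat G ev r s)
      \<subseteq> (\<Union>w\<in>Poly_Mapping.keys (fox_word s r). {free_lift G ev w})"
    unfolding fox_mat_eq gr_proj_def
    by (rule order_trans[OF keys_sum]) (auto split: if_splits)
  ultimately show ?thesis by (auto simp: gring_def)
qed

lemma fox_mat_outside:
  assumes "s \<notin> fst ` set r"
  shows "fox_mat G ev r s = 0"
proof -
  have "fox_word s r = 0" using assms by (induction r) auto
  then show ?thesis by (simp add: fox_mat_eq gr_proj_def)
qed


section \<open>Skipping one index\<close>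

lemma insert_index_less: "p \<le> n \<Longrightarrow> insert_index p i < Suc n \<longleftrightarrow> i < n"
  by (auto simp: insert_index_def)

lemma insert_index_exclude' [simp]: "p \<noteq> insert_index p i"
  by (rule insert_index_exclude[symmetric])

lemma insert_index_inject [simp]: "insert_index p i = insert_index p j \<longleftrightarrow> i = j"
  using insert_index_inj_on[of p UNIV] by (simp add: inj_eq)

text \<open>Arguments about matrices and automorphisms of rank \<open>Suc n\<close> split along this dichotomy into the
  new index and the old ones, so that the order of \<open>i\<close> and \<open>p\<close> never has to be considered.\<close>

lemma index_cases:
  assumes "p \<le> n" "i < Suc n"
  obtains "i = p" | j where "i = insert_index p j" "j < n"
  using assms insert_delete_index[of i p] insert_index_less[of p n "delete_index p i"] by metis

lemma sum_insert_index:
  fixes f :: "nat \<Rightarrow> 'c::comm_monoid_add"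
  assumes "p \<le> n"
  shows "(\<Sum>k<Suc n. f k) = f p + (\<Sum>k<n. f (insert_index p k))"
proof -
  have "(\<Sum>k<Suc n. f k) = f p + (\<Sum>k\<in>{..<Suc n} - {p}. f k)"
    using assms by (intro sum.remove) auto
  also have "{..<Suc n} - {p} = insert_index p ` {..<n}"
    using insert_index_image[of p n] assms by (simp add: atLeast0LessThan)
  finally show ?thesis by (simp add: sum.reindex insert_index_inj_on)
qed

lemma insert_index_subset: "p \<le> n \<Longrightarrow> A \<subseteq> {..<n} \<Longrightarrow> insert_index p ` A \<subseteq> {..<Suc n}"
  by (auto simp: insert_index_def)

lemma insert_index_notin: "p \<notin> insert_index p ` A"
proof (rule notI, elim imageE)
  fix i assume "p = insert_index p i"
  with insert_index_exclude[of p i, symmetric] show False by (rule notE)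
qed

lemma delete_index_subset:
  "p \<le> n \<Longrightarrow> p \<notin> A \<Longrightarrow> A \<subseteq> {..<Suc n} \<Longrightarrow> delete_index p ` A \<subseteq> {..<n}"
proof
  fix j assume p: "p \<le> n" "p \<notin> A" "A \<subseteq> {..<Suc n}" and "j \<in> delete_index p ` A"
  then obtain i where i: "j = delete_index p i" "i \<in> A" by blast
  then have "i \<noteq> p" "i < Suc n" using p by auto
  then show "j \<in> {..<n}" using p(1) by (auto simp: i(1) delete_index_def)
qed

lemma card_insert_image [simp]: "card (insert_index p ` A) = card A"
  by (rule card_image[OF insert_index_inj_on])

lemma card_avoiding:
  assumes "A \<subseteq> {..n}"
  shows "card {p. p \<le> n \<and> p \<notin> A} = Suc n - card A"
proof -
  have "{p. p \<le> n \<and> p \<notin> A} = {..n} - A" by auto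
  then show ?thesis using assms by (simp add: card_Diff_subset finite_subset)
qed

lemma sum_avoiding:
  fixes x :: "'h \<Rightarrow>\<^sub>0 real"
  assumes "A \<subseteq> {..n}"
  shows "(\<Sum>p\<le>n. if p \<notin> A then x else 0) = gr_scale (real (Suc n - card A)) x"
proof -
  have "(\<Sum>p\<le>n. if p \<notin> A then x else 0) = (\<Sum>p | p \<le> n \<and> p \<notin> A. x)"
    by (intro sum.mono_neutral_cong_right) auto
  then show ?thesis by (simp add: gr_sum_const card_avoiding[OF assms])
qed

section \<open>Averaging over the deletion of one index\<close>

text \<open>Families of groups whose generators and relators carry sets of indices below \<open>n\<close>. The sets
  \<open>all_gens\<close> and \<open>all_rels\<close> contain the symbols and relators of all ranks at once, and rank \<open>n\<close>
  selects those with indices below \<open>n\<close>; this reduces statements about the change of rank to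
  invariance under the renaming \<open>act f\<close> of indices. A renaming has to be injective only on the
  indices that occur, which allows \<open>delete_index p\<close> on symbols that avoid \<open>p\<close>. The homomorphism
  \<open>emb n p\<close> realizes the renaming by \<open>insert_index p\<close>.\<close>

locale index_family =
  fixes G :: "nat \<Rightarrow> ('g, 'b) monoid_scheme"
    and gens :: "nat \<Rightarrow> 's set" and ev :: "nat \<Rightarrow> 's \<Rightarrow> 'g" and ix :: "'s \<Rightarrow> nat set"
    and rels :: "nat \<Rightarrow> 's word set"
    and all_gens :: "'s set" and all_rels :: "'s word set"
    and act :: "(nat \<Rightarrow> nat) \<Rightarrow> 's \<Rightarrow> 's"
    and emb :: "nat \<Rightarrow> nat \<Rightarrow> 'g \<Rightarrow> 'g"
  assumes group_G: "group (G n)"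
    and finite_gens: "finite (gens n)"
    and finite_rels: "finite (rels n)"
    and gens_eq: "gens n = {s \<in> all_gens. ix s \<subseteq> {..<n}}"
    and rels_eq: "rels n = {r \<in> all_rels. word_ix ix r \<subseteq> {..<n}}"
    and ev_carrier: "ev n \<in> gens n \<rightarrow> carrier (G n)"
    and card_ix: "s \<in> all_gens \<Longrightarrow> card (ix s) = 2"
    and letters_all_rels: "r \<in> all_rels \<Longrightarrow> fst ` set r \<subseteq> all_gens"
    and ix_act: "ix (act f s) = f ` ix s"
    and act_act: "act f (act g s) = act (f \<circ> g) s"
    and act_trivial: "(\<And>i. i \<in> ix s \<Longrightarrow> f i = i) \<Longrightarrow> act f s = s"
    and act_all_gens: "s \<in> all_gens \<Longrightarrow> inj_on f (ix s) \<Longrightarrow> act f s \<in> all_gens"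
    and act_all_rels: "r \<in> all_rels \<Longrightarrow> inj_on f (word_ix ix r) \<Longrightarrow> relabel (act f) r \<in> all_rels"
    and emb_hom: "p \<le> n \<Longrightarrow> emb n p \<in> hom (G n) (G (Suc n))"
    and emb_ev: "p \<le> n \<Longrightarrow> s \<in> gens n \<Longrightarrow>
      ev (Suc n) (act (insert_index p) s) = emb n p (ev n s)"
begin

abbreviation "Adj n \<equiv> adj (G n) (ev n) ix (rels n)"

abbreviation "push n p \<equiv> push_mat (emb n p) (act (insert_index p)) (gens n)"

lemma ix_subset: "s \<in> gens n \<Longrightarrow> ix s \<subseteq> {..<n}"
  by (simp add: gens_eq)

lemma rels_letters:
  assumes "r \<in> rels n"
  shows "fst ` set r \<subseteq> gens n"
proof
  fix s assume s: "s \<in> fst ` set r"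
  have "r \<in> all_rels" "word_ix ix r \<subseteq> {..<n}" using assms unfolding rels_eq by blast+
  moreover have "ix s \<subseteq> word_ix ix r" using s unfolding word_ix_def by blast
  ultimately show "s \<in> gens n" using s letters_all_rels[of r] unfolding gens_eq by blast
qed

lemma word_ix_relabel: "word_ix ix (relabel (act f) r) = f ` word_ix ix r"
  by (auto simp: word_ix_def ix_act)

lemma relabel_relabel: "relabel (act f) (relabel (act g) r) = relabel (act (f \<circ> g)) r"
  by (auto simp: act_act)

lemma relabel_trivial: "(\<And>i. i \<in> word_ix ix r \<Longrightarrow> f i = i) \<Longrightarrow> relabel (act f) r = r"
proof (rule map_idI)
  fix x assume f: "\<And>i. i \<in> word_ix ix r \<Longrightarrow> f i = i" and x: "x \<in> set r"
  have "act f (fst x) = fst x"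
    by (rule act_trivial, rule f) (use x in \<open>auto simp: word_ix_def\<close>)
  then show "apfst (act f) x = x" by (simp add: prod_eq_iff)
qed

lemma inj_act_insert: "inj (act (insert_index p))"
proof (rule inj_on_inverseI)
  show "act (delete_index p) (act (insert_index p) s) = s" for s
    unfolding act_act by (rule act_trivial) (simp only: o_apply delete_insert_index)
qed

text \<open>A symbol that avoids \<open>p\<close> is the renaming by \<open>insert_index p\<close> of its renaming by
  \<open>delete_index p\<close>; the same holds for relators.\<close>

lemma gens_insert:
  assumes "p \<le> n"
  shows "act (insert_index p) ` gens n = {s \<in> gens (Suc n). p \<notin> ix s}"
proof (intro equalityI subsetI)
  fix s' assume "s' \<in> act (insert_index p) ` gens n"
  then obtain s where s: "s' = act (insert_index p) s" "s \<in> all_gens" "ix s \<subseteq> {..<n}"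
    unfolding gens_eq by blast
  then have "s' \<in> all_gens" by (simp only: act_all_gens insert_index_inj_on)
  moreover have "ix s' \<subseteq> {..<Suc n}"
    unfolding s(1) ix_act by (rule insert_index_subset[OF assms s(3)])
  moreover have "p \<notin> ix s'"
    unfolding s(1) ix_act by (rule insert_index_notin)
  ultimately show "s' \<in> {s \<in> gens (Suc n). p \<notin> ix s}" unfolding gens_eq by blast
next
  fix s assume "s \<in> {s \<in> gens (Suc n). p \<notin> ix s}"
  then have s: "s \<in> all_gens" "ix s \<subseteq> {..<Suc n}" "p \<notin> ix s"
    unfolding gens_eq by blast+
  have "act (delete_index p) s \<in> all_gens"
    by (rule act_all_gens[OF s(1) delete_index_inj_on[OF s(3)]])
  moreover have "ix (act (delete_index p) s) \<subseteq> {..<n}"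
    unfolding ix_act by (rule delete_index_subset[OF assms s(3,2)])
  ultimately have mem: "act (delete_index p) s \<in> gens n" unfolding gens_eq by blast
  have eq: "act (insert_index p) (act (delete_index p) s) = s"
    unfolding act_act
  proof (rule act_trivial)
    fix i assume "i \<in> ix s"
    then have "i \<noteq> p" using s(3) by blast
    then show "(insert_index p \<circ> delete_index p) i = i" by (simp add: insert_delete_index)
  qed
  show "s \<in> act (insert_index p) ` gens n"
    by (rule image_eqI[where f = "act (insert_index p)", OF eq[symmetric] mem])
qed

lemma rels_insert:
  assumes "p \<le> n"
  shows "relabel (act (insert_index p)) ` rels n = {s \<in> rels (Suc n). p \<notin> word_ix ix s}"
proof (intro equalityI subsetI)
  fix s' assume "s' \<in> relabel (act (insert_index p)) ` rels n"
  then obtain s where s: "s' = relabel (act (insert_index p)) s" "s \<in> all_rels" "word_ix ix s \<subseteq> {..<n}"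
    unfolding rels_eq by blast
  then have "s' \<in> all_rels" by (simp only: act_all_rels insert_index_inj_on)
  moreover have "word_ix ix s' \<subseteq> {..<Suc n}"
    unfolding s(1) word_ix_relabel by (rule insert_index_subset[OF assms s(3)])
  moreover have "p \<notin> word_ix ix s'"
    unfolding s(1) word_ix_relabel by (rule insert_index_notin)
  ultimately show "s' \<in> {s \<in> rels (Suc n). p \<notin> word_ix ix s}" unfolding rels_eq by blast
next
  fix s assume "s \<in> {s \<in> rels (Suc n). p \<notin> word_ix ix s}"
  then have s: "s \<in> all_rels" "word_ix ix s \<subseteq> {..<Suc n}" "p \<notin> word_ix ix s"
    unfolding rels_eq by blast+
  have "relabel (act (delete_index p)) s \<in> all_rels"
    by (rule act_all_rels[OF s(1) delete_index_inj_on[OF s(3)]])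
  moreover have "word_ix ix (relabel (act (delete_index p)) s) \<subseteq> {..<n}"
    unfolding word_ix_relabel by (rule delete_index_subset[OF assms s(3,2)])
  ultimately have mem: "relabel (act (delete_index p)) s \<in> rels n" unfolding rels_eq by blast
  have eq: "relabel (act (insert_index p)) (relabel (act (delete_index p)) s) = s"
    unfolding relabel_relabel
  proof (rule relabel_trivial)
    fix i assume "i \<in> word_ix ix s"
    then have "i \<noteq> p" using s(3) by blast
    then show "(insert_index p \<circ> delete_index p) i = i" by (simp add: insert_delete_index)
  qed
  show "s \<in> relabel (act (insert_index p)) ` rels n"
    by (rule image_eqI[where f = "relabel (act (insert_index p))", OF eq[symmetric] mem])
qed

lemma word_ix_subset: "r \<in> rels n \<Longrightarrow> word_ix ix r \<subseteq> {..<n}"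
  by (simp add: rels_eq)

text \<open>For \<open>s\<close> and \<open>t\<close> without the index \<open>p\<close>, the relators of rank \<open>n\<close> correspond to the relators of
  rank \<open>Suc n\<close> that avoid \<open>p\<close>, and the summands agree by naturality of Fox derivatives. If \<open>p\<close>
  is an index of \<open>s\<close>, say, then the left side vanishes by the extension by zero and the right
  side because \<open>s\<close> does not occur in a relator that avoids \<open>p\<close>.\<close>

lemma push_adj_plus:
  assumes p: "p \<le> n" and st: "s \<in> gens (Suc n)" "t \<in> gens (Suc n)"
  shows "push n p (adj_plus (G n) (ev n) ix (rels n)) s t =
    (\<Sum>r | r \<in> rels (Suc n) \<and> card (word_ix ix r) = 3 \<and> p \<notin> word_ix ix r.
      gr_mult (G (Suc n)) (gr_star (G (Suc n)) (fox_mat (G (Suc n)) (ev (Suc n)) r s))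
        (fox_mat (G (Suc n)) (ev (Suc n)) r t))" (is "?l = (\<Sum>r\<in>?R. ?f r s t)")
proof (cases "p \<in> ix s \<or> p \<in> ix t")
  case True
  have "?f r s t = 0" if "r \<in> ?R" for r
  proof -
    have "s \<notin> fst ` set r \<or> t \<notin> fst ` set r"
      using True that by (auto simp: word_ix_def)
    then show ?thesis by (auto simp: fox_mat_outside)
  qed
  moreover have "?l = 0"
    using True gens_insert[OF p] by (intro push_mat_outside) auto
  ultimately show ?thesis by simp
next
  case False
  let ?\<theta> = "act (insert_index p)"
  obtain s' t' where s': "s = ?\<theta> s'" "s' \<in> gens n" and t': "t = ?\<theta> t'" "t' \<in> gens n"
    using False st gens_insert[OF p] by blast
  have R: "?R = relabel ?\<theta> ` {r \<in> rels n. card (word_ix ix r) = 3}"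
  proof -
    have "?R = {r \<in> relabel ?\<theta> ` rels n. card (word_ix ix r) = 3}"
      unfolding rels_insert[OF p] by blast
    also have "\<dots> = relabel ?\<theta> ` {r \<in> rels n. card (word_ix ix (relabel ?\<theta> r)) = 3}"
      by blast
    finally show ?thesis unfolding word_ix_relabel card_insert_image .
  qed
  have inj: "inj_on (relabel ?\<theta>) A" for A
    using inj_act_insert[of p] by (intro inj_on_subset[OF inj_mapI]) simp_all
  have *: "gr_map (emb n p) (gr_mult (G n) (gr_star (G n) (fox_mat (G n) (ev n) r s'))
      (fox_mat (G n) (ev n) r t')) = ?f (relabel ?\<theta> r) s t" if "r \<in> rels n" for r
  proof -
    note r = rels_letters[OF that]
    have "fox_mat (G n) (ev n) r u \<in> gring (G n)" for u
      by (rule fox_mat_gring[OF group_G ev_carrier r])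
    moreover have "fox_mat (G (Suc n)) (ev (Suc n)) (relabel ?\<theta> r) (?\<theta> u)
        = gr_map (emb n p) (fox_mat (G n) (ev n) r u)" for u
      by (rule fox_mat_relabel[OF group_G group_G emb_hom[OF p] inj_act_insert ev_carrier _ r])
        (rule emb_ev[OF p])
    ultimately show ?thesis
      by (simp add: s' t' gr_map_mult[OF emb_hom[OF p]]
          gr_map_star[OF group_G group_G emb_hom[OF p]] gring_star group_G)
  qed
  have "?l = gr_map (emb n p) (adj_plus (G n) (ev n) ix (rels n) s' t')"
    unfolding s' t' by (intro push_mat_apply s' t' inj_on_subset[OF inj_act_insert]) simp
  also have "\<dots> = (\<Sum>r\<in>?R. ?f r s t)"
    unfolding R sum.reindex[OF inj] adj_plus_def gr_map_sum by (rule sum.cong) (auto simp: *)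
  finally show ?thesis .
qed

lemma push_adj_minus:
  assumes p: "p \<le> n" and st: "s \<in> gens (Suc n)" "t \<in> gens (Suc n)"
  shows "push n p (adj_minus (G n) (ev n) ix) s t =
    (if p \<notin> ix s \<union> ix t then adj_minus (G (Suc n)) (ev (Suc n)) ix s t else 0)"
proof (cases "p \<in> ix s \<or> p \<in> ix t")
  case True
  then have "push n p (adj_minus (G n) (ev n) ix) s t = 0"
    using gens_insert[OF p] by (intro push_mat_outside) auto
  then show ?thesis using True by auto
next
  case False
  let ?\<theta> = "act (insert_index p)"
  obtain s' t' where s': "s = ?\<theta> s'" "s' \<in> gens n" and t': "t = ?\<theta> t'" "t' \<in> gens n"
    using False st gens_insert[OF p] by blast
  interpret h: group_hom "G n" "G (Suc n)" "emb n p"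
    using emb_hom[OF p] by (simp add: group_hom_def group_hom_axioms_def group_G)
  have c: "ev n s' \<in> carrier (G n)" "ev n t' \<in> carrier (G n)"
    using s' t' ev_carrier by auto
  have ix: "ix s \<union> ix t = insert_index p ` (ix s' \<union> ix t')"
    by (simp add: s' t' ix_act image_Un)
  define a where "a u = (gr_one (G n) - gr_of (ev n u) :: 'g \<Rightarrow>\<^sub>0 real)" for u
  have a: "a s' \<in> gring (G n)" "a t' \<in> gring (G n)"
    unfolding a_def using c by (auto intro!: gring_diff gring_single)
  have map_a: "gr_map (emb n p) (a u) = gr_one (G (Suc n)) - gr_of (ev (Suc n) (?\<theta> u))"
    if "u \<in> gens n" for u
    by (simp add: a_def gr_map_diff emb_ev[OF p that])
  have "gr_map (emb n p) (gr_mult (G n) (a s') (gr_star (G n) (a t')))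
      = gr_mult (G (Suc n)) (gr_map (emb n p) (a s')) (gr_star (G (Suc n)) (gr_map (emb n p) (a t')))"
    by (simp add: gr_map_mult[OF emb_hom[OF p]] gr_map_star[OF group_G group_G emb_hom[OF p]]
        gring_star group_G a)
  then have "gr_map (emb n p) (adj_minus (G n) (ev n) ix s' t')
      = adj_minus (G (Suc n)) (ev (Suc n)) ix s t"
    unfolding adj_minus_def ix card_insert_image map_a[OF s'(2)] map_a[OF t'(2)]
    by (simp add: a_def s' t')
  moreover have "push n p (adj_minus (G n) (ev n) ix) s t
      = gr_map (emb n p) (adj_minus (G n) (ev n) ix s' t')"
    unfolding s' t' by (intro push_mat_apply s' t' inj_on_subset[OF inj_act_insert]) simp
  ultimately show ?thesis using False by simp
qed

lemma push_scalar:
  assumes p: "p \<le> n" and st: "s \<in> gens (Suc n)" "t \<in> gens (Suc n)"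
  shows "push n p (scalar_mat (G n) c) s t =
    (if p \<notin> ix s then scalar_mat (G (Suc n)) c s t else 0)"
proof (cases "p \<in> ix s \<or> p \<in> ix t")
  case True
  then have "push n p (scalar_mat (G n) c) s t = 0"
    using gens_insert[OF p] by (intro push_mat_outside) auto
  then show ?thesis using True by (auto simp: scalar_mat_def)
next
  case False
  let ?\<theta> = "act (insert_index p)"
  obtain s' t' where s': "s = ?\<theta> s'" "s' \<in> gens n" and t': "t = ?\<theta> t'" "t' \<in> gens n"
    using False st gens_insert[OF p] by blast
  interpret h: group_hom "G n" "G (Suc n)" "emb n p"
    using emb_hom[OF p] by (simp add: group_hom_def group_hom_axioms_def group_G)
  have "push n p (scalar_mat (G n) c) s t = gr_map (emb n p) (scalar_mat (G n) c s' t')"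
    unfolding s' t' by (intro push_mat_apply s' t' inj_on_subset[OF inj_act_insert]) simp
  then show ?thesis
    using False by (simp add: s' t' scalar_mat_def inj_eq[OF inj_act_insert])
qed

text \<open>Exchanging the sum over \<open>p\<close> with the sum over the relators, every relator with three indices
  is counted once for each of the \<open>Suc n - 3\<close> indices that it avoids. The entries of the negative
  part are counted in the same way.\<close>

lemma sum_push_adj:
  assumes st: "s \<in> gens (Suc n)" "t \<in> gens (Suc n)"
  shows "(\<Sum>p\<le>n. push n p (Adj n) s t) = gr_scale (real (n - 2)) (Adj (Suc n) s t)"
proof -
  have ixs: "ix s \<subseteq> {..n}" "ix t \<subseteq> {..n}"
    using ix_subset[of _ "Suc n"] st by (auto simp: lessThan_Suc_atMost)
  define R where "R = {r \<in> rels (Suc n). card (word_ix ix r) = 3}"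
  define f where "f r = gr_mult (G (Suc n)) (gr_star (G (Suc n)) (fox_mat (G (Suc n)) (ev (Suc n)) r s))
        (fox_mat (G (Suc n)) (ev (Suc n)) r t)" for r
  have "push n p (adj_plus (G n) (ev n) ix (rels n)) s t
      = (\<Sum>r\<in>R. if p \<notin> word_ix ix r then f r else 0)" if "p \<le> n" for p
    unfolding push_adj_plus[OF that st] R_def f_def using finite_rels[of "Suc n"]
    by (intro sum.mono_neutral_cong_left) auto
  then have "(\<Sum>p\<le>n. push n p (adj_plus (G n) (ev n) ix (rels n)) s t)
      = (\<Sum>p\<le>n. \<Sum>r\<in>R. if p \<notin> word_ix ix r then f r else 0)" by simp
  also have "\<dots> = (\<Sum>r\<in>R. \<Sum>p\<le>n. if p \<notin> word_ix ix r then f r else 0)"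
    by (rule sum.swap)
  also have "\<dots> = (\<Sum>r\<in>R. gr_scale (real (n - 2)) (f r))"
  proof (rule sum.cong)
    fix r assume r: "r \<in> R"
    then have "word_ix ix r \<subseteq> {..n}" "card (word_ix ix r) = 3"
      using word_ix_subset[of r "Suc n"] by (auto simp: R_def lessThan_Suc_atMost)
    then show "(\<Sum>p\<le>n. if p \<notin> word_ix ix r then f r else 0) = gr_scale (real (n - 2)) (f r)"
      by (simp only: sum_avoiding) simp
  qed simp
  also have "\<dots> = gr_scale (real (n - 2)) (adj_plus (G (Suc n)) (ev (Suc n)) ix (rels (Suc n)) s t)"
    by (simp add: gr_scale_sum adj_plus_def R_def f_def)
  finally have plus: "(\<Sum>p\<le>n. push n p (adj_plus (G n) (ev n) ix (rels n)) s t) = \<dots>" .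
  have minus: "(\<Sum>p\<le>n. push n p (adj_minus (G n) (ev n) ix) s t)
      = gr_scale (real (n - 2)) (adj_minus (G (Suc n)) (ev (Suc n)) ix s t)"
  proof (cases "card (ix s \<union> ix t) = 3")
    case True
    have "(\<Sum>p\<le>n. push n p (adj_minus (G n) (ev n) ix) s t)
        = (\<Sum>p\<le>n. if p \<notin> ix s \<union> ix t then adj_minus (G (Suc n)) (ev (Suc n)) ix s t else 0)"
      by (rule sum.cong) (auto simp only: push_adj_minus[OF _ st] atMost_iff)
    also have "\<dots> = gr_scale (real (Suc n - card (ix s \<union> ix t))) (adj_minus (G (Suc n)) (ev (Suc n)) ix s t)"
      using ixs by (intro sum_avoiding) auto
    finally show ?thesis using True by simp
  next
    case False
    then have zero: "adj_minus (G (Suc n)) (ev (Suc n)) ix s t = 0" by (simp add: adj_minus_def)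
    have "push n p (adj_minus (G n) (ev n) ix) s t = 0" if "p \<le> n" for p
      by (simp only: push_adj_minus[OF that st] zero if_cancel)
    then show ?thesis by (simp add: zero)
  qed
  have "push n p (Adj n) s t = push n p (adj_plus (G n) (ev n) ix (rels n)) s t
      + push n p (adj_minus (G n) (ev n) ix) s t" for p
    by (simp add: push_mat_def adj_def gr_map_add)
  then have "(\<Sum>p\<le>n. push n p (Adj n) s t)
      = (\<Sum>p\<le>n. push n p (adj_plus (G n) (ev n) ix (rels n)) s t)
        + (\<Sum>p\<le>n. push n p (adj_minus (G n) (ev n) ix) s t)"
    by (simp only: sum.distrib)
  also have "\<dots> = gr_scale (real (n - 2)) (Adj (Suc n) s t)"
    unfolding plus minus adj_def by (rule gr_scale_add[symmetric])
  finally show ?thesis .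
qed

text \<open>A diagonal entry involves only the two indices of one generator, so it is counted once more
  often than the pieces in \<open>sum_push_adj\<close>. This difference produces the growth of the constant.\<close>

lemma sum_push_scalar:
  assumes st: "s \<in> gens (Suc n)" "t \<in> gens (Suc n)"
  shows "(\<Sum>p\<le>n. push n p (scalar_mat (G n) c) s t)
    = gr_scale (real (n - 1)) (scalar_mat (G (Suc n)) c s t)"
proof -
  have "(\<Sum>p\<le>n. push n p (scalar_mat (G n) c) s t)
      = (\<Sum>p\<le>n. if p \<notin> ix s then scalar_mat (G (Suc n)) c s t else 0)"
    by (intro sum.cong refl push_scalar[OF _ st]) simp
  also have "\<dots> = gr_scale (real (Suc n - card (ix s))) (scalar_mat (G (Suc n)) c s t)"
    using ix_subset[OF st(1)] by (intro sum_avoiding) (auto simp: lessThan_Suc_atMost)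
  also have "Suc n - card (ix s) = n - 1" using st(1) card_ix[of s] by (simp add: gens_eq)
  finally show ?thesis .
qed

lemma sum_of_squares_Suc:
  assumes n: "n \<ge> 3"
    and sos: "sum_of_squares (G n) (gens n) (\<lambda>s t. Adj n s t - scalar_mat (G n) c s t)"
  shows "sum_of_squares (G (Suc n)) (gens (Suc n))
    (\<lambda>s t. Adj (Suc n) s t - scalar_mat (G (Suc n)) ((real n - 1) / (real n - 2) * c) s t)"
proof -
  let ?M = "\<lambda>s t. Adj n s t - scalar_mat (G n) c s t"
  have "sum_of_squares (G (Suc n)) (gens (Suc n)) (push n p ?M)" if "p \<le> n" for p
  proof (rule sum_of_squares_push[OF group_G group_G emb_hom[OF that] _ _ finite_gens sos])
    show "inj_on (act (insert_index p)) (gens n)"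
      by (rule inj_on_subset[OF inj_act_insert]) simp
    show "act (insert_index p) ` gens n \<subseteq> gens (Suc n)"
      unfolding gens_insert[OF that] by auto
  qed
  then have "sum_of_squares (G (Suc n)) (gens (Suc n))
      (\<lambda>s t. gr_scale (1 / (real n - 2)) (\<Sum>p\<le>n. push n p ?M s t))"
    using n by (intro sum_of_squares_scale sum_of_squares_sum) auto
  also have "?this \<longleftrightarrow> ?thesis"
  proof (rule sum_of_squares_cong)
    fix s t assume st: "s \<in> gens (Suc n)" "t \<in> gens (Suc n)"
    have "push n p ?M s t = push n p (Adj n) s t - push n p (scalar_mat (G n) c) s t" for p
      by (simp add: push_mat_def gr_map_diff)
    then have "(\<Sum>p\<le>n. push n p ?M s t)
        = gr_scale (real (n - 2)) (Adj (Suc n) s t) - gr_scale (real (n - 1)) (scalar_mat (G (Suc n)) c s t)"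
      by (simp add: sum_subtractf sum_push_adj[OF st] sum_push_scalar[OF st])
    then show "gr_scale (1 / (real n - 2)) (\<Sum>p\<le>n. push n p ?M s t)
        = Adj (Suc n) s t - scalar_mat (G (Suc n)) ((real n - 1) / (real n - 2) * c) s t"
      using n by (simp add: gr_scale_diff gr_scale_scale of_nat_diff scalar_mat_def)
  qed
  finally show ?thesis .
qed

theorem sum_of_squares_stable:
  assumes "m \<ge> 3" "n \<ge> m"
    and "sum_of_squares (G m) (gens m) (\<lambda>s t. Adj m s t - scalar_mat (G m) c s t)"
  shows "sum_of_squares (G n) (gens n)
    (\<lambda>s t. Adj n s t - scalar_mat (G n) ((real n - 2) / (real m - 2) * c) s t)"
  using assms(2)
proof (induction n rule: dec_induct)
  case base
  have eq: "(real m - 2) / (real m - 2) * c = c" using assms(1) by simp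
  show ?case unfolding eq by (rule assms(3))
next
  case (step n)
  have n: "n \<ge> 3" using step.hyps(1) assms(1) by linarith
  then have "real n - 2 \<noteq> 0" by simp
  then have eq: "(real n - 1) / (real n - 2) * ((real n - 2) / (real m - 2) * c)
      = (real (Suc n) - 2) / (real m - 2) * c"
    by simp
  show ?case using sum_of_squares_Suc[OF n step.IH] unfolding eq .
qed

end


section \<open>Inserting an index into the special linear group\<close>

text \<open>The block matrix with entry \<open>1\<close> at \<open>p\<close> and with \<open>A\<close> on the remaining indices.\<close>

definition emb_mat :: "nat \<Rightarrow> nat \<Rightarrow> int mat \<Rightarrow> int mat" where
  "emb_mat n p A = mat (Suc n) (Suc n) (\<lambda>(i, j). if i = p \<or> j = p then (if i = j then 1 else 0)
    else A $$ (delete_index p i, delete_index p j))"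

lemma emb_mat_index:
  assumes "p \<le> n" "i < n" "j < n"
  shows "emb_mat n p A $$ (insert_index p i, insert_index p j) = A $$ (i, j)"
    and "emb_mat n p A $$ (p, insert_index p j) = 0"
    and "emb_mat n p A $$ (insert_index p i, p) = 0"
    and "emb_mat n p A $$ (p, p) = 1"
proof -
  have "insert_index p i < Suc n" "insert_index p j < Suc n" "p < Suc n"
    using assms by (simp_all add: insert_index_less)
  then show "emb_mat n p A $$ (insert_index p i, insert_index p j) = A $$ (i, j)"
    and "emb_mat n p A $$ (p, insert_index p j) = 0"
    and "emb_mat n p A $$ (insert_index p i, p) = 0"
    and "emb_mat n p A $$ (p, p) = 1"
    by (simp_all add: emb_mat_def)
qed

lemma emb_mat_diag: "p \<le> n \<Longrightarrow> emb_mat n p A $$ (p, p) = 1"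
  by (simp add: emb_mat_def)

lemma dim_emb_mat [simp]: "emb_mat n p A \<in> carrier_mat (Suc n) (Suc n)"
  "dim_row (emb_mat n p A) = Suc n" "dim_col (emb_mat n p A) = Suc n"
  by (simp_all add: emb_mat_def)

lemma eq_mat_insert_index:
  assumes "p \<le> n" "A \<in> carrier_mat (Suc n) (Suc n)" "B \<in> carrier_mat (Suc n) (Suc n)"
    and "A $$ (p, p) = B $$ (p, p)"
    and "\<And>j. j < n \<Longrightarrow> A $$ (p, insert_index p j) = B $$ (p, insert_index p j)"
    and "\<And>i. i < n \<Longrightarrow> A $$ (insert_index p i, p) = B $$ (insert_index p i, p)"
    and "\<And>i j. i < n \<Longrightarrow> j < n \<Longrightarrow>
      A $$ (insert_index p i, insert_index p j) = B $$ (insert_index p i, insert_index p j)"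
  shows "A = B"
proof (rule eq_matI)
  fix i j assume "i < dim_row B" "j < dim_col B"
  then have "i < Suc n" "j < Suc n" using assms(3) by auto
  then show "A $$ (i, j) = B $$ (i, j)"
    using assms(4-7) by (elim index_cases[OF assms(1)]) auto
qed (use assms in auto)

lemma emb_mat_mult:
  assumes p: "p \<le> n" and A: "A \<in> carrier_mat n n" and B: "B \<in> carrier_mat n n"
  shows "emb_mat n p (A * B) = emb_mat n p A * emb_mat n p B"
proof -
  have less: "insert_index p i < Suc n" if "i < n" for i
    using that p by (simp add: insert_index_less)
  have prod: "(emb_mat n p A * emb_mat n p B) $$ (i, j)
      = emb_mat n p A $$ (i, p) * emb_mat n p B $$ (p, j)
        + (\<Sum>k<n. emb_mat n p A $$ (i, insert_index p k) * emb_mat n p B $$ (insert_index p k, j))"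
    if "i < Suc n" "j < Suc n" for i j
    using that by (simp add: scalar_prod_def atLeast0LessThan sum_insert_index[OF p] del: sum.lessThan_Suc)
  have AB: "(A * B) $$ (i, j) = (\<Sum>k<n. A $$ (i, k) * B $$ (k, j))" if "i < n" "j < n" for i j
    using that A B by (simp add: scalar_prod_def atLeast0LessThan)
  show ?thesis
    by (rule eq_mat_insert_index[OF p])
      (use p less in \<open>simp_all add: prod emb_mat_index emb_mat_diag AB mult_carrier_mat[of _ _ "Suc n"] del: index_mult_mat(1)\<close>)
qed

text \<open>Laplace expansion along row \<open>p\<close>, which has a single nonzero entry, at the diagonal.\<close>

lemma det_emb_mat:
  assumes p: "p \<le> n" and A: "A \<in> carrier_mat n n"
  shows "det (emb_mat n p A) = det A"
proof -
  have "det (emb_mat n p A) = (\<Sum>j<Suc n. emb_mat n p A $$ (p, j) * cofactor (emb_mat n p A) p j)"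
    using p by (intro laplace_expansion_row) auto
  also have "\<dots> = cofactor (emb_mat n p A) p p"
    by (simp add: sum_insert_index[OF p] emb_mat_index emb_mat_diag p del: sum.lessThan_Suc)
  also have "\<dots> = det (mat_delete (emb_mat n p A) p p)"
    by (simp add: cofactor_def flip: mult_2)
  also have "mat_delete (emb_mat n p A) p p = A"
  proof (rule eq_matI)
    fix i j assume ij: "i < dim_row A" "j < dim_col A"
    then have "mat_delete (emb_mat n p A) p p $$ (i, j)
        = emb_mat n p A $$ (insert_index p i, insert_index p j)"
      using A by (simp add: mat_delete_def insert_index_def)
    then show "mat_delete (emb_mat n p A) p p $$ (i, j) = A $$ (i, j)"
      using ij A p by (simp add: emb_mat_index)
  qed (use A in auto)
  finally show ?thesis .
qed

lemma emb_mat_hom: "p \<le> n \<Longrightarrow> emb_mat n p \<in> hom (SL n) (SL (Suc n))"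
  by (auto simp: hom_def SL_def emb_mat_mult det_emb_mat)

lemma emb_mat_addrow_mat:
  assumes p: "p \<le> n" and "i < n" "j < n" "i \<noteq> j"
  shows "emb_mat n p (addrow_mat n 1 i j) = addrow_mat (Suc n) 1 (insert_index p i) (insert_index p j)"
proof -
  have less: "insert_index p i < Suc n" if "i < n" for i
    using that p by (simp add: insert_index_less)
  show ?thesis
    by (rule eq_mat_insert_index[OF p])
      (use assms less in \<open>auto simp: emb_mat_index emb_mat_diag\<close>)
qed


section \<open>Words without reference to the rank\<close>

abbreviation comm_word :: "'s \<times> bool \<Rightarrow> 's \<times> bool \<Rightarrow> 's word" where
  "comm_word x y \<equiv> [x, y, apsnd Not x, apsnd Not y]"

lemma free_group_mult: "u \<otimes>\<^bsub>free_group S\<^esub> v = foldr red_cons u v"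
  by (simp add: free_group_def)

lemma free_group_one: "\<one>\<^bsub>free_group S\<^esub> = []"
  by (simp add: free_group_def)

lemma free_group_inv_letter:
  assumes "fst x \<in> S"
  shows "inv\<^bsub>free_group S\<^esub> [x] = [apsnd Not x]"
proof -
  interpret group "free_group S" by (rule group_free_group)
  show ?thesis
    by (rule inv_equality) (use assms in \<open>auto simp: free_group_def cancels_def\<close>)
qed

lemma free_group_commutator_letters:
  assumes "fst x \<in> S" "fst y \<in> S" "fst x \<noteq> fst y"
  shows "commutator (free_group S) [x] [y] = comm_word x y"
  using assms by (auto simp: commutator_def free_group_inv_letter free_group_mult cancels_def)

lemma free_group_int_pow_gen:
  assumes "s \<in> S"
  shows "gen s [^]\<^bsub>free_group S\<^esub> (1 :: int) = gen s"
    and "gen s [^]\<^bsub>free_group S\<^esub> (- 1 :: int) = [(s, False)]"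
proof -
  interpret group "free_group S" by (rule group_free_group)
  have g: "gen s \<in> carrier (free_group S)" using assms by (simp add: free_group_def)
  then show "gen s [^]\<^bsub>free_group S\<^esub> (1 :: int) = gen s" by (rule int_pow_1)
  then show "gen s [^]\<^bsub>free_group S\<^esub> (- 1 :: int) = [(s, False)]"
    using int_pow_neg[OF g, of 1] assms by (simp add: free_group_inv_letter)
qed

text \<open>The relators are given as images of index tuples under group operations in the free group of
  rank \<open>n\<close>. Once these operations are evaluated to explicit words \<open>w\<close>, from which the indices
  can be read off, the bound on the tuple becomes a bound on the indices of the word. The
  following lemmas do this for the shapes of index tuples that occur.\<close>

lemma indexed_words2:
  assumes "\<And>i j. {i, j} \<subseteq> I \<Longrightarrow> P i j \<Longrightarrow> T i j = w i j"
    and "\<And>i j. P i j \<Longrightarrow> word_ix ix (w i j) = {i, j}"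
  shows "{T i j | i j. {i, j} \<subseteq> I \<and> P i j}
    = {r. (\<exists>i j. r = w i j \<and> P i j) \<and> word_ix ix r \<subseteq> I}"
  unfolding set_eq_iff mem_Collect_eq using assms by metis

lemma indexed_words3:
  assumes "\<And>i j k. {i, j, k} \<subseteq> I \<Longrightarrow> P i j k \<Longrightarrow> T i j k = w i j k"
    and "\<And>i j k. P i j k \<Longrightarrow> word_ix ix (w i j k) = {i, j, k}"
  shows "{T i j k | i j k. {i, j, k} \<subseteq> I \<and> P i j k}
    = {r. (\<exists>i j k. r = w i j k \<and> P i j k) \<and> word_ix ix r \<subseteq> I}"
  unfolding set_eq_iff mem_Collect_eq using assms by metis

lemma indexed_words4:
  assumes "\<And>i j k l. {i, j, k, l} \<subseteq> I \<Longrightarrow> P i j k l \<Longrightarrow> T i j k l = w i j k l"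
    and "\<And>i j k l. P i j k l \<Longrightarrow> word_ix ix (w i j k l) = {i, j, k, l}"
  shows "{T i j k l | i j k l. {i, j, k, l} \<subseteq> I \<and> P i j k l}
    = {r. (\<exists>i j k l. r = w i j k l \<and> P i j k l) \<and> word_ix ix r \<subseteq> I}"
  unfolding set_eq_iff mem_Collect_eq using assms by metis

text \<open>The exponent \<open>e\<close> becomes the sign \<open>b\<close> of a letter.\<close>

lemma indexed_words_sign:
  assumes "\<And>i j k. {i, j, k} \<subseteq> I \<Longrightarrow> P i j k \<Longrightarrow> T i j k (1 :: int) = w i j k True"
    and "\<And>i j k. {i, j, k} \<subseteq> I \<Longrightarrow> P i j k \<Longrightarrow> T i j k (- 1) = w i j k False"
    and "\<And>i j k b. P i j k \<Longrightarrow> word_ix ix (w i j k b) = {i, j, k}"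
  shows "{T i j k e | i j k e. {i, j, k} \<subseteq> I \<and> P i j k \<and> e \<in> {1, - 1}}
    = {r. (\<exists>i j k b. r = w i j k b \<and> P i j k) \<and> word_ix ix r \<subseteq> I}"
proof (rule Set.set_eqI)
  fix r
  have "r \<in> {T i j k e | i j k e. {i, j, k} \<subseteq> I \<and> P i j k \<and> e \<in> {1, - 1}}
    \<longleftrightarrow> (\<exists>i j k. {i, j, k} \<subseteq> I \<and> P i j k \<and> (r = T i j k 1 \<or> r = T i j k (- 1)))"
    by blast
  also have "\<dots> \<longleftrightarrow> (\<exists>i j k. {i, j, k} \<subseteq> I \<and> P i j k \<and> (r = w i j k True \<or> r = w i j k False))"
    using assms(1,2) by metis
  also have "\<dots> \<longleftrightarrow> (\<exists>i j k b. {i, j, k} \<subseteq> I \<and> P i j k \<and> r = w i j k b)"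
    by (metis (full_types))
  also have "\<dots> \<longleftrightarrow> r \<in> {r. (\<exists>i j k b. r = w i j k b \<and> P i j k) \<and> word_ix ix r \<subseteq> I}"
    unfolding mem_Collect_eq using assms(3) by metis
  finally show "r \<in> {T i j k e | i j k e. {i, j, k} \<subseteq> I \<and> P i j k \<and> e \<in> {1, - 1}}
    \<longleftrightarrow> r \<in> {r. (\<exists>i j k b. r = w i j k b \<and> P i j k) \<and> word_ix ix r \<subseteq> I}" .
qed


section \<open>Stability for the special linear groups\<close>

fun sl_act :: "(nat \<Rightarrow> nat) \<Rightarrow> sl_gen \<Rightarrow> sl_gen" where
  "sl_act f (Elem i j) = Elem (f i) (f j)"

text \<open>The relators of all ranks. Writing out the letters makes the indices of a relator visible, and
  these determine the ranks in which it occurs.\<close>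

inductive_set sl_words :: "sl_gen word set" where
  commute: "i \<noteq> j \<Longrightarrow> k \<noteq> l \<Longrightarrow> i \<noteq> l \<Longrightarrow> j \<noteq> k \<Longrightarrow> (i, j) \<noteq> (k, l) \<Longrightarrow>
    comm_word (Elem i j, True) (Elem k l, True) \<in> sl_words"
| product: "distinct [i, j, k] \<Longrightarrow>
    comm_word (Elem i j, True) (Elem j k, True) @ [(Elem i k, False)] \<in> sl_words"

lemma sl_rels_eq: "sl_rels n = {r \<in> sl_words. word_ix sl_ix r \<subseteq> {..<n}}"
proof -
  let ?F = "free_group (sl_gens n)"
  have commute: "{commutator ?F (gen (Elem i j)) (gen (Elem k l)) | i j k l.
      {i, j, k, l} \<subseteq> {..<n} \<and> i \<noteq> j \<and> k \<noteq> l \<and> i \<noteq> l \<and> j \<noteq> k \<and> (i, j) \<noteq> (k, l)}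
    = {r. (\<exists>i j k l. r = comm_word (Elem i j, True) (Elem k l, True)
        \<and> i \<noteq> j \<and> k \<noteq> l \<and> i \<noteq> l \<and> j \<noteq> k \<and> (i, j) \<noteq> (k, l)) \<and> word_ix sl_ix r \<subseteq> {..<n}}"
  proof (rule indexed_words4)
    fix i j k l assume "{i, j, k, l} \<subseteq> {..<n}"
      "i \<noteq> j \<and> k \<noteq> l \<and> i \<noteq> l \<and> j \<noteq> k \<and> (i, j) \<noteq> (k, l)"
    then show "commutator ?F (gen (Elem i j)) (gen (Elem k l))
        = comm_word (Elem i j, True) (Elem k l, True)"
      by (intro free_group_commutator_letters) (auto simp: sl_gens_def)
  qed (auto simp: word_ix_def)
  have product: "{commutator ?F (gen (Elem i j)) (gen (Elem j k)) \<otimes>\<^bsub>?F\<^esub> inv\<^bsub>?F\<^esub> gen (Elem i k) | i j k.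
      {i, j, k} \<subseteq> {..<n} \<and> distinct [i, j, k]}
    = {r. (\<exists>i j k. r = comm_word (Elem i j, True) (Elem j k, True) @ [(Elem i k, False)]
        \<and> distinct [i, j, k]) \<and> word_ix sl_ix r \<subseteq> {..<n}}"
  proof (rule indexed_words3)
    fix i j k assume ijk: "{i, j, k} \<subseteq> {..<n}" "distinct [i, j, k]"
    then have "Elem i j \<in> sl_gens n" "Elem j k \<in> sl_gens n" "Elem i k \<in> sl_gens n"
      by (auto simp: sl_gens_def)
    then show "commutator ?F (gen (Elem i j)) (gen (Elem j k)) \<otimes>\<^bsub>?F\<^esub> inv\<^bsub>?F\<^esub> gen (Elem i k)
        = comm_word (Elem i j, True) (Elem j k, True) @ [(Elem i k, False)]"
      using ijk(2)
      by (simp add: free_group_commutator_letters free_group_inv_letter)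
        (simp add: free_group_mult cancels_def)
  qed (auto simp: word_ix_def)
  show ?thesis
    unfolding sl_rels_def Let_def commute product
    by (rule Set.set_eqI) (simp only: Un_iff mem_Collect_eq sl_words.simps conj_disj_distribR)
qed

lemma sl_act_words:
  assumes "r \<in> sl_words" "inj_on f (word_ix sl_ix r)"
  shows "relabel (sl_act f) r \<in> sl_words"
  using assms
proof (cases rule: sl_words.cases)
  case (commute i j k l)
  then have "inj_on f {i, j, k, l}" using assms(2) by (simp add: word_ix_def insert_commute)
  then have "comm_word (Elem (f i) (f j), True) (Elem (f k) (f l), True) \<in> sl_words"
    using commute by (intro sl_words.commute) (auto simp: inj_on_def)
  then show ?thesis by (simp add: commute)
next
  case (product i j k)
  then have "inj_on f {i, j, k}" using assms(2) by (simp add: word_ix_def insert_commute)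
  then have "comm_word (Elem (f i) (f j), True) (Elem (f j) (f k), True) @ [(Elem (f i) (f k), False)]
      \<in> sl_words"
    using product by (intro sl_words.product) (auto simp: inj_on_def)
  then show ?thesis by (simp add: product)
qed

interpretation sl: index_family SL sl_gens sl_ev sl_ix sl_rels "{Elem i j | i j. i \<noteq> j}" sl_words
  sl_act emb_mat
proof (rule index_family.intro)
  show "group (SL n)" for n by (rule group_SL)
  show "finite (sl_rels n)" for n by (rule finite_sl_rels)
  show "sl_rels n = {r \<in> sl_words. word_ix sl_ix r \<subseteq> {..<n}}" for n by (rule sl_rels_eq)
  show "finite (sl_gens n)" for n
    by (rule finite_subset[of _ "\<Union>i<n. \<Union>j<n. {Elem i j}"]) (auto simp: sl_gens_def)
  show "sl_gens n = {s \<in> {Elem i j | i j. i \<noteq> j}. sl_ix s \<subseteq> {..<n}}" for n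
    by (auto simp: sl_gens_def)
  show "sl_ev n \<in> sl_gens n \<rightarrow> carrier (SL n)" for n by (simp add: sl_ev_carrier)
  show "card (sl_ix s) = 2" if "s \<in> {Elem i j | i j. i \<noteq> j}" for s using that by auto
  show "fst ` set r \<subseteq> {Elem i j | i j. i \<noteq> j}" if "r \<in> sl_words" for r
    using that by cases auto
  show "sl_ix (sl_act f s) = f ` sl_ix s" for f s by (cases s) simp
  show "sl_act f (sl_act g s) = sl_act (f \<circ> g) s" for f g s by (cases s) simp
  show "sl_act f s = s" if "\<And>i. i \<in> sl_ix s \<Longrightarrow> f i = i" for f s
    using that by (cases s) simp
  show "sl_act f s \<in> {Elem i j | i j. i \<noteq> j}"
    if "s \<in> {Elem i j | i j. i \<noteq> j}" "inj_on f (sl_ix s)" for f s using that by auto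
  show "relabel (sl_act f) r \<in> sl_words" if "r \<in> sl_words" "inj_on f (word_ix sl_ix r)" for f r
    by (rule sl_act_words[OF that])
  show "emb_mat n p \<in> hom (SL n) (SL (Suc n))" if "p \<le> n" for n p
    by (rule emb_mat_hom[OF that])
  show "sl_ev (Suc n) (sl_act (insert_index p) s) = emb_mat n p (sl_ev n s)"
    if "p \<le> n" "s \<in> sl_gens n" for n p s
    using that by (auto simp: sl_gens_def emb_mat_addrow_mat)
qed


section \<open>Endomorphisms of free groups\<close>

text \<open>Every word is a product of generators and their inverses.\<close>

lemma free_group_hom_unique:
  assumes "group H" "h \<in> hom (free_group S) H" "h' \<in> hom (free_group S) H"
    and eq: "\<And>s. s \<in> S \<Longrightarrow> h (gen s) = h' (gen s)" and "w \<in> carrier (free_group S)"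
  shows "h w = h' w"
proof -
  let ?F = "free_group S"
  interpret h: group_hom ?F H h
    using assms by (simp add: group_hom_def group_hom_axioms_def group_free_group)
  interpret h': group_hom ?F H h'
    using assms by (simp add: group_hom_def group_hom_axioms_def group_free_group)
  have letter: "h [x] = h' [x]" if "fst x \<in> S" for x
  proof (cases "snd x")
    case True
    then have x: "[x] = gen (fst x)" by (cases x) simp
    show ?thesis unfolding x by (rule eq[OF that])
  next
    case False
    then have x: "[x] = inv\<^bsub>?F\<^esub> gen (fst x)"
      using that by (cases x) (simp add: free_group_inv_letter)
    have "gen (fst x) \<in> carrier ?F" using that by (simp add: free_group_def)
    then show ?thesis unfolding x by (simp only: h.hom_inv h'.hom_inv eq[OF that])
  qed
  show ?thesis
    using assms(5)
  proof (induction w)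
    case Nil
    have "[] = \<one>\<^bsub>?F\<^esub>" by (simp add: free_group_def)
    then show ?case using h.hom_one h'.hom_one by metis
  next
    case (Cons x w)
    then have x: "[x] \<in> carrier ?F" "w \<in> carrier ?F" "fst x \<in> S" "x # w = [x] \<otimes>\<^bsub>?F\<^esub> w"
      by (auto simp: free_group_def reduced_Cons red_cons_reduced)
    show ?case
      unfolding x(4) h.hom_mult[OF x(1,2)] h'.hom_mult[OF x(1,2)] letter[OF x(3)] Cons.IH[OF x(2)] ..
  qed
qed

lemma reduced_relabel: "inj f \<Longrightarrow> reduced (relabel f w) \<longleftrightarrow> reduced w"
  by (simp add: successively_map cancels_def inj_eq)

lemma relabel_hom:
  assumes "inj f" "f ` S \<subseteq> T"
  shows "relabel f \<in> hom (free_group S) (free_group T)"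
proof (rule homI)
  fix u assume "u \<in> carrier (free_group S)"
  then show "relabel f u \<in> carrier (free_group T)"
    using assms by (auto simp: free_group_def reduced_relabel image_image)
next
  fix u v
  have "relabel f (foldr red_cons u v) = foldr red_cons (relabel f u) (relabel f v)"
    by (induction u) (simp_all add: red_cons_relabel[OF assms(1), symmetric])
  then show "relabel f (u \<otimes>\<^bsub>free_group S\<^esub> v) = relabel f u \<otimes>\<^bsub>free_group T\<^esub> relabel f v"
    by (simp only: free_group_mult)
qed

abbreviation FG :: "nat \<Rightarrow> nat word monoid" where
  "FG n \<equiv> free_group {..<n}"

text \<open>Automorphisms in \<open>SAut n\<close> are extensional functions. With the same convention for
  endomorphisms, values on the generators determine the function itself.\<close>

definition endos :: "nat \<Rightarrow> (nat word \<Rightarrow> nat word) set" where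
  "endos n = hom (FG n) (FG n) \<inter> extensional (carrier (FG n))"

definition endo :: "nat \<Rightarrow> (nat \<Rightarrow> nat word) \<Rightarrow> nat word \<Rightarrow> nat word" where
  "endo n \<phi> = restrict (free_lift (FG n) \<phi>) (carrier (FG n))"

lemma gen_carrier: "i < n \<Longrightarrow> gen i \<in> carrier (FG n)"
  by (simp add: free_group_def)

lemma endo_endos:
  assumes "\<And>i. i < n \<Longrightarrow> \<phi> i \<in> carrier (FG n)"
  shows "endo n \<phi> \<in> endos n"
proof -
  interpret group "FG n" by (rule group_free_group)
  have "free_lift (FG n) \<phi> \<in> hom (FG n) (FG n)"
    using assms by (intro free_lift_hom group_free_group) auto
  then show ?thesis by (auto simp: endos_def endo_def hom_def Pi_iff)
qed

lemma endo_gen: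
  assumes "\<And>i. i < n \<Longrightarrow> \<phi> i \<in> carrier (FG n)" "i < n"
  shows "endo n \<phi> (gen i) = \<phi> i"
  using free_lift_hom(2)[OF group_free_group, of \<phi> "{..<n}" "{..<n}" i] assms gen_carrier[OF assms(2)]
  by (simp add: endo_def Pi_iff)

lemma endos_closed: "\<alpha> \<in> endos n \<Longrightarrow> w \<in> carrier (FG n) \<Longrightarrow> \<alpha> w \<in> carrier (FG n)"
  by (auto simp: endos_def hom_def)

lemma endos_eqI:
  assumes "\<alpha> \<in> endos n" "\<beta> \<in> endos n" "\<And>i. i < n \<Longrightarrow> \<alpha> (gen i) = \<beta> (gen i)"
  shows "\<alpha> = \<beta>"
proof (rule extensionalityI[of _ "carrier (FG n)"])
  fix w assume "w \<in> carrier (FG n)"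
  then show "\<alpha> w = \<beta> w"
    using assms by - (rule free_group_hom_unique[OF group_free_group, of \<alpha> "{..<n}" "{..<n}"],
        auto simp: endos_def)
qed (use assms in \<open>auto simp: endos_def\<close>)

lemma compose_endos:
  assumes "\<alpha> \<in> endos n" "\<beta> \<in> endos n"
  shows "compose (carrier (FG n)) \<alpha> \<beta> \<in> endos n"
proof -
  interpret group "FG n" by (rule group_free_group)
  have h: "\<alpha> \<in> hom (FG n) (FG n)" "\<beta> \<in> hom (FG n) (FG n)"
    using assms by (auto simp: endos_def)
  have "compose (carrier (FG n)) \<alpha> \<beta> \<in> hom (FG n) (FG n)"
    by (rule homI) (auto simp: compose_eq hom_mult[OF h(1)] hom_mult[OF h(2)]
      hom_in_carrier[OF h(1)] hom_in_carrier[OF h(2)])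
  then show ?thesis by (simp add: endos_def)
qed

abbreviation id_endo :: "nat \<Rightarrow> nat word \<Rightarrow> nat word" where
  "id_endo n \<equiv> restrict (\<lambda>w. w) (carrier (FG n))"

lemma id_endos: "id_endo n \<in> endos n"
proof -
  interpret group "FG n" by (rule group_free_group)
  show ?thesis by (auto simp: endos_def hom_def)
qed

lemma SAutI:
  assumes "\<alpha> \<in> endos n" "\<beta> \<in> endos n"
    and "compose (carrier (FG n)) \<alpha> \<beta> = id_endo n" "compose (carrier (FG n)) \<beta> \<alpha> = id_endo n"
    and "det (ab_mat n \<alpha>) = 1"
  shows "\<alpha> \<in> carrier (SAut n)"
proof -
  have "bij_betw \<alpha> (carrier (FG n)) (carrier (FG n))"
  proof (rule bij_betwI)
    show "\<alpha> \<in> carrier (FG n) \<rightarrow> carrier (FG n)" "\<beta> \<in> carrier (FG n) \<rightarrow> carrier (FG n)"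
      using assms by (auto intro: endos_closed)
    fix w assume w: "w \<in> carrier (FG n)"
    show "\<beta> (\<alpha> w) = w" using fun_cong[OF assms(4), of w] w by (simp add: compose_eq)
    show "\<alpha> (\<beta> w) = w" using fun_cong[OF assms(3), of w] w by (simp add: compose_eq)
  qed
  then show ?thesis using assms(1,5) by (simp add: SAut_def auto_def Bij_def endos_def)
qed

lemma SAutD:
  assumes "\<alpha> \<in> carrier (SAut n)"
  shows "\<alpha> \<in> endos n" "det (ab_mat n \<alpha>) = 1"
  using assms by (auto simp: SAut_def auto_def Bij_def endos_def)

lemma SAut_mult:
  assumes "\<alpha> \<in> carrier (SAut n)" "\<beta> \<in> carrier (SAut n)"
  shows "\<alpha> \<otimes>\<^bsub>SAut n\<^esub> \<beta> = compose (carrier (FG n)) \<alpha> \<beta>"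
  using assms by (simp add: SAut_def AutoGroup_def BijGroup_def auto_def)

lemma SAut_one: "\<one>\<^bsub>SAut n\<^esub> = id_endo n"
  by (simp add: SAut_def AutoGroup_def BijGroup_def)


section \<open>Inserting a free generator\<close>

abbreviation ins :: "nat \<Rightarrow> nat word \<Rightarrow> nat word" where
  "ins p \<equiv> relabel (insert_index p)"

definition emb_aut :: "nat \<Rightarrow> nat \<Rightarrow> (nat word \<Rightarrow> nat word) \<Rightarrow> nat word \<Rightarrow> nat word" where
  "emb_aut n p \<alpha> = endo (Suc n) (\<lambda>k. if k = p then gen p else ins p (\<alpha> (gen (delete_index p k))))"

lemma ins_hom: "p \<le> n \<Longrightarrow> ins p \<in> hom (FG n) (FG (Suc n))"
  by (intro relabel_hom insert_index_inj_on image_subsetI) (simp add: insert_index_less)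

lemma ins_carrier: "p \<le> n \<Longrightarrow> w \<in> carrier (FG n) \<Longrightarrow> ins p w \<in> carrier (FG (Suc n))"
  by (rule hom_in_carrier[OF ins_hom])

context
  fixes n p :: nat and \<alpha> :: "nat word \<Rightarrow> nat word"
  assumes p: "p \<le> n" and \<alpha>: "\<alpha> \<in> endos n"
begin

lemma emb_aut_images:
  assumes "k < Suc n"
  shows "(if k = p then gen p else ins p (\<alpha> (gen (delete_index p k)))) \<in> carrier (FG (Suc n))"
proof (rule index_cases[OF p assms])
  assume "k = p"
  then show ?thesis using gen_carrier[OF assms] by simp
next
  fix j assume j: "k = insert_index p j" "j < n"
  have "ins p (\<alpha> (gen j)) \<in> carrier (FG (Suc n))"
    by (intro ins_carrier p endos_closed[OF \<alpha>] gen_carrier j)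
  then show ?thesis unfolding j(1) by simp
qed

lemma emb_aut_endos: "emb_aut n p \<alpha> \<in> endos (Suc n)"
  unfolding emb_aut_def by (rule endo_endos[OF emb_aut_images])

lemma emb_aut_new: "emb_aut n p \<alpha> (gen p) = gen p"
  using p by (simp add: emb_aut_def endo_gen[OF emb_aut_images])

lemma emb_aut_gen: "j < n \<Longrightarrow> emb_aut n p \<alpha> (gen (insert_index p j)) = ins p (\<alpha> (gen j))"
  using insert_index_less[OF p, of j] by (simp add: emb_aut_def endo_gen[OF emb_aut_images])

text \<open>Both sides are homomorphisms in \<open>w\<close> that agree on generators. Thus \<open>emb_aut n p \<alpha>\<close> restricts
  to \<open>\<alpha>\<close> on the free factor spanned by the generators other than \<open>p\<close>.\<close>

lemma emb_aut_ins:
  assumes "w \<in> carrier (FG n)"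
  shows "emb_aut n p \<alpha> (ins p w) = ins p (\<alpha> w)"
proof -
  have h: "\<alpha> \<in> hom (FG n) (FG n)" "emb_aut n p \<alpha> \<in> hom (FG (Suc n)) (FG (Suc n))"
    using \<alpha> emb_aut_endos by (auto simp: endos_def)
  have "(emb_aut n p \<alpha> \<circ> ins p) w = (ins p \<circ> \<alpha>) w"
  proof (rule free_group_hom_unique[OF group_free_group _ _ _ assms])
    show "emb_aut n p \<alpha> \<circ> ins p \<in> hom (FG n) (FG (Suc n))"
      by (rule hom_compose[OF ins_hom[OF p] h(2)])
    show "ins p \<circ> \<alpha> \<in> hom (FG n) (FG (Suc n))"
      by (rule hom_compose[OF h(1) ins_hom[OF p]])
  qed (simp add: emb_aut_gen)
  then show ?thesis by simp
qed

text \<open>The images of the old generators avoid the new one, and the new generator is fixed.\<close>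

lemma ab_mat_emb_aut: "ab_mat (Suc n) (emb_aut n p \<alpha>) = emb_mat n p (ab_mat n \<alpha>)"
proof -
  have ins: "exp_sum (insert_index p i) (ins p w) = exp_sum i w" for i w
    by (simp add: exp_sum_def comp_def cong: if_cong)
  have new: "exp_sum p (ins p w) = 0" for w
    by (simp add: exp_sum_def comp_def)
  have less: "insert_index p i < Suc n" if "i < n" for i
    using that p by (simp add: insert_index_less)
  show ?thesis
  proof (rule eq_mat_insert_index[OF p])
    show "ab_mat (Suc n) (emb_aut n p \<alpha>) \<in> carrier_mat (Suc n) (Suc n)" by (simp add: ab_mat_def)
  qed (use p less in \<open>simp_all add: emb_mat_index emb_mat_diag,
        simp_all add: ab_mat_def emb_aut_new emb_aut_gen ins new, simp_all add: exp_sum_def\<close>)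
qed

end

text \<open>On an old generator, \<open>emb_aut n p \<beta>\<close> yields a word in the old generators, where \<open>emb_aut_ins\<close>
  evaluates \<open>emb_aut n p \<alpha>\<close>.\<close>

lemma emb_aut_compose:
  assumes p: "p \<le> n" and "\<alpha> \<in> endos n" "\<beta> \<in> endos n"
  shows "emb_aut n p (compose (carrier (FG n)) \<alpha> \<beta>)
    = compose (carrier (FG (Suc n))) (emb_aut n p \<alpha>) (emb_aut n p \<beta>)"
proof (rule endos_eqI)
  note emb = emb_aut_endos[OF p]
  show "emb_aut n p (compose (carrier (FG n)) \<alpha> \<beta>) \<in> endos (Suc n)"
    by (intro emb compose_endos assms)
  show "compose (carrier (FG (Suc n))) (emb_aut n p \<alpha>) (emb_aut n p \<beta>) \<in> endos (Suc n)"
    by (intro emb compose_endos assms)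
  fix k assume k: "k < Suc n"
  note e = assms(2,3) compose_endos[OF assms(2,3)]
  have "emb_aut n p (compose (carrier (FG n)) \<alpha> \<beta>) (gen k)
      = emb_aut n p \<alpha> (emb_aut n p \<beta> (gen k))"
  proof (rule index_cases[OF p k])
    assume k: "k = p"
    show ?thesis unfolding k by (simp only: emb_aut_new[OF p] e)
  next
    fix j assume j: "k = insert_index p j" "j < n"
    note g = gen_carrier[OF j(2)]
    show ?thesis
      unfolding j(1) emb_aut_gen[OF p e(3) j(2)] emb_aut_gen[OF p e(2) j(2)]
        emb_aut_ins[OF p e(1) endos_closed[OF e(2) g]] compose_eq[OF g] ..
  qed
  then show "emb_aut n p (compose (carrier (FG n)) \<alpha> \<beta>) (gen k)
      = compose (carrier (FG (Suc n))) (emb_aut n p \<alpha>) (emb_aut n p \<beta>) (gen k)"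
    by (simp only: compose_eq[OF gen_carrier[OF k]])
qed

lemma emb_aut_id:
  assumes p: "p \<le> n"
  shows "emb_aut n p (id_endo n) = id_endo (Suc n)"
proof (rule endos_eqI[OF emb_aut_endos[OF p id_endos] id_endos])
  fix k assume k: "k < Suc n"
  have "emb_aut n p (id_endo n) (gen k) = gen k"
  proof (rule index_cases[OF p k])
    assume "k = p"
    then show ?thesis by (simp only: emb_aut_new[OF p id_endos])
  next
    fix j assume j: "k = insert_index p j" "j < n"
    have "id_endo n (gen j) = gen j" using gen_carrier[OF j(2)] by (rule restrict_apply')
    then show ?thesis unfolding j(1) emb_aut_gen[OF p id_endos j(2)] by simp
  qed
  then show "emb_aut n p (id_endo n) (gen k) = id_endo (Suc n) (gen k)"
    by (simp only: restrict_apply'[OF gen_carrier[OF k]])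
qed

text \<open>The extension of \<open>\<alpha>\<close> is bijective because the extension of its inverse is inverse to it.\<close>

lemma emb_aut_hom:
  assumes p: "p \<le> n"
  shows "emb_aut n p \<in> hom (SAut n) (SAut (Suc n))"
proof (rule homI)
  interpret group "SAut n" by (rule group_SAut)
  show closed: "emb_aut n p \<alpha> \<in> carrier (SAut (Suc n))" if \<alpha>: "\<alpha> \<in> carrier (SAut n)" for \<alpha>
  proof (rule SAutI)
    let ?\<beta> = "inv\<^bsub>SAut n\<^esub> \<alpha>"
    have \<beta>: "?\<beta> \<in> carrier (SAut n)" using \<alpha> by simp
    note e = SAutD(1)[OF \<alpha>] SAutD(1)[OF \<beta>]
    show "emb_aut n p \<alpha> \<in> endos (Suc n)" "emb_aut n p ?\<beta> \<in> endos (Suc n)"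
      by (rule emb_aut_endos[OF p e(1)], rule emb_aut_endos[OF p e(2)])
    have "compose (carrier (FG n)) \<alpha> ?\<beta> = id_endo n" "compose (carrier (FG n)) ?\<beta> \<alpha> = id_endo n"
      using SAut_mult[OF \<alpha> \<beta>] SAut_mult[OF \<beta> \<alpha>] r_inv[OF \<alpha>] l_inv[OF \<alpha>] SAut_one by simp_all
    then show "compose (carrier (FG (Suc n))) (emb_aut n p \<alpha>) (emb_aut n p ?\<beta>) = id_endo (Suc n)"
      "compose (carrier (FG (Suc n))) (emb_aut n p ?\<beta>) (emb_aut n p \<alpha>) = id_endo (Suc n)"
      using e p by (simp_all add: emb_aut_compose[symmetric] emb_aut_id)
    show "det (ab_mat (Suc n) (emb_aut n p \<alpha>)) = 1"
    proof -
      have "ab_mat n \<alpha> \<in> carrier_mat n n" by (simp add: ab_mat_def)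
      then show ?thesis
        unfolding ab_mat_emb_aut[OF p e(1)] by (simp add: det_emb_mat[OF p] SAutD(2)[OF \<alpha>])
    qed
  qed
  fix \<alpha> \<beta> assume "\<alpha> \<in> carrier (SAut n)" "\<beta> \<in> carrier (SAut n)"
  then show "emb_aut n p (\<alpha> \<otimes>\<^bsub>SAut n\<^esub> \<beta>) = emb_aut n p \<alpha> \<otimes>\<^bsub>SAut (Suc n)\<^esub> emb_aut n p \<beta>"
    using p by (simp add: SAut_mult closed emb_aut_compose SAutD(1))
qed


section \<open>Transvections\<close>

text \<open>The images of the free generators under the automorphism denoted by a symbol (\<open>b = True\<close>) or
  under its inverse (\<open>b = False\<close>): the sign \<open>b\<close> belongs to the letter by which the generator is
  multiplied.\<close>

fun transvection :: "bool \<Rightarrow> saut_gen \<Rightarrow> nat \<Rightarrow> nat word" where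
  "transvection b (Lam i j) k = (if k = i then [(j, b), (i, True)] else gen k)"
| "transvection b (Rho i j) k = (if k = i then [(i, True), (j, b)] else gen k)"

lemma saut_gens_iff:
  "s \<in> saut_gens n \<longleftrightarrow> (\<exists>i j. (s = Lam i j \<or> s = Rho i j) \<and> i \<noteq> j \<and> i < n \<and> j < n)"
  by (auto simp: saut_gens_def)

lemma transvection_carrier:
  "s \<in> saut_gens n \<Longrightarrow> k < n \<Longrightarrow> transvection b s k \<in> carrier (FG n)"
  by (auto simp: saut_gens_iff free_group_def cancels_def split: if_splits)

lemma saut_ev_eq: "s \<in> saut_gens n \<Longrightarrow> saut_ev n s = endo n (transvection True s)"
proof -
  assume "s \<in> saut_gens n"
  then obtain i j where s: "s = Lam i j \<or> s = Rho i j" and ij: "i \<noteq> j"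
    unfolding saut_gens_iff by blast
  from s show ?thesis
  proof
    assume s: "s = Lam i j"
    have "(\<lambda>k. if k = i then gen j \<otimes>\<^bsub>FG n\<^esub> gen i else gen k) = transvection True s"
      using ij by (auto simp: s free_group_mult cancels_def)
    then show ?thesis by (simp add: s Let_def endo_def)
  next
    assume s: "s = Rho i j"
    have "(\<lambda>k. if k = i then gen i \<otimes>\<^bsub>FG n\<^esub> gen j else gen k) = transvection True s"
      using ij by (auto simp: s free_group_mult cancels_def)
    then show ?thesis by (simp add: s Let_def endo_def)
  qed
qed

lemma transvection_inverse:
  assumes s: "s \<in> saut_gens n"
  shows "compose (carrier (FG n)) (endo n (transvection b s)) (endo n (transvection (\<not> b) s)) = id_endo n"
proof (rule endos_eqI[OF compose_endos id_endos])
  interpret group "FG n" by (rule group_free_group)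
  have e: "endo n (transvection c s) \<in> endos n" for c
    by (rule endo_endos[OF transvection_carrier[OF s]])
  then show "endo n (transvection b s) \<in> endos n" "endo n (transvection (\<not> b) s) \<in> endos n" by auto
  fix k assume k: "k < n"
  have c: "transvection (\<not> b) s k \<in> carrier (FG n)" by (rule transvection_carrier[OF s k])
  have "endo n (transvection b s) (transvection (\<not> b) s k) = gen k"
  proof -
    have "free_lift (FG n) (transvection b s) (transvection (\<not> b) s k) = gen k"
      using s k by (auto simp: saut_gens_iff free_lift_def free_group_inv_letter free_group_mult
          free_group_one cancels_def)
    then show ?thesis using c by (simp add: endo_def)
  qed
  then show "compose (carrier (FG n)) (endo n (transvection b s)) (endo n (transvection (\<not> b) s)) (gen k)
      = id_endo n (gen k)"
    using gen_carrier[OF k] k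
    by (simp add: compose_eq endo_gen[OF transvection_carrier[OF s]])
qed

text \<open>Left and right multiplication by \<open>s\<^sub>j\<close> have the same effect on the abelianization: column \<open>i\<close>
  gains a \<open>1\<close> in row \<open>j\<close>, which makes the matrix elementary.\<close>

lemma ab_mat_transvection:
  assumes "s \<in> saut_gens n"
  shows "det (ab_mat n (endo n (transvection True s))) = 1"
proof -
  obtain i j where s: "s = Lam i j \<or> s = Rho i j" and ij: "i \<noteq> j" "i < n" "j < n"
    using assms unfolding saut_gens_iff by blast
  have "ab_mat n (endo n (transvection True s)) = addrow_mat n 1 j i"
  proof (rule eq_matI)
    fix a b assume "a < dim_row (addrow_mat n (1::int) j i)" "b < dim_col (addrow_mat n (1::int) j i)"
    then have "a < n" "b < n" by simp_all
    then show "ab_mat n (endo n (transvection True s)) $$ (a, b) = addrow_mat n 1 j i $$ (a, b)"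
      using s ij by (auto simp: ab_mat_def endo_gen[OF transvection_carrier[OF assms]] exp_sum_def)
  qed (simp_all add: ab_mat_def)
  then show ?thesis using ij det_addrow_mat[of j i n 1] by simp
qed

lemma saut_ev_carrier:
  assumes "s \<in> saut_gens n"
  shows "saut_ev n s \<in> carrier (SAut n)"
  unfolding saut_ev_eq[OF assms]
proof (rule SAutI)
  show "endo n (transvection True s) \<in> endos n" "endo n (transvection False s) \<in> endos n"
    by (rule endo_endos[OF transvection_carrier[OF assms]], assumption)+
  show "compose (carrier (FG n)) (endo n (transvection True s)) (endo n (transvection False s)) = id_endo n"
    "compose (carrier (FG n)) (endo n (transvection False s)) (endo n (transvection True s)) = id_endo n"
    using transvection_inverse[OF assms, of True] transvection_inverse[OF assms, of False] by simp_all
  show "det (ab_mat n (endo n (transvection True s))) = 1"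
    by (rule ab_mat_transvection[OF assms])
qed

fun saut_act :: "(nat \<Rightarrow> nat) \<Rightarrow> saut_gen \<Rightarrow> saut_gen" where
  "saut_act f (Lam i j) = Lam (f i) (f j)"
| "saut_act f (Rho i j) = Rho (f i) (f j)"

lemma emb_aut_saut_ev:
  assumes p: "p \<le> n" and s: "s \<in> saut_gens n"
  shows "saut_ev (Suc n) (saut_act (insert_index p) s) = emb_aut n p (saut_ev n s)"
proof -
  let ?t = "saut_act (insert_index p) s"
  have t: "?t \<in> saut_gens (Suc n)"
    using s p by (auto simp: saut_gens_iff insert_index_less)
  have e: "endo n (transvection True s) \<in> endos n"
    by (rule endo_endos[OF transvection_carrier[OF s]])
  show ?thesis
    unfolding saut_ev_eq[OF s] saut_ev_eq[OF t]
  proof (rule endos_eqI)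
    show "endo (Suc n) (transvection True ?t) \<in> endos (Suc n)"
      by (rule endo_endos[OF transvection_carrier[OF t]])
    show "emb_aut n p (endo n (transvection True s)) \<in> endos (Suc n)"
      by (rule emb_aut_endos[OF p e])
    fix k assume k: "k < Suc n"
    have "transvection True ?t k = emb_aut n p (endo n (transvection True s)) (gen k)"
    proof (rule index_cases[OF p k])
      assume k: "k = p"
      have "transvection True ?t p = gen p" by (cases s) simp_all
      then show ?thesis unfolding k emb_aut_new[OF p e] .
    next
      fix j assume k: "k = insert_index p j" "j < n"
      have "transvection True ?t (insert_index p j) = ins p (transvection True s j)"
        by (cases s) simp_all
      moreover have "endo n (transvection True s) (gen j) = transvection True s j"
        by (rule endo_gen[OF transvection_carrier[OF s] k(2)])
      ultimately show ?thesis unfolding k(1) emb_aut_gen[OF p e k(2)] by simp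
    qed
    then show "endo (Suc n) (transvection True ?t) (gen k)
        = emb_aut n p (endo n (transvection True s)) (gen k)"
      by (simp add: endo_gen[OF transvection_carrier[OF t]] k)
  qed
qed


section \<open>Stability for the special automorphism groups of free groups\<close>

text \<open>Again the relators of all ranks. The sign \<open>b\<close> of a letter stands for the exponent \<open>\<plusminus>1\<close>; in
  the last two families, which multiply \<open>\<lambda>\<close> by \<open>\<rho>\<close> or conversely, the second occurrence of the
  exponent carries the opposite sign.\<close>

inductive_set saut_words :: "saut_gen word set" where
  lam_rho: "distinct [i, j] \<Longrightarrow> comm_word (Lam i j, True) (Rho i j, True) \<in> saut_words"
| lam_lam: "distinct [i, j, k, l] \<Longrightarrow> comm_word (Lam i j, True) (Lam k l, True) \<in> saut_words"
| rho_rho: "distinct [i, j, k, l] \<Longrightarrow> comm_word (Rho i j, True) (Rho k l, True) \<in> saut_words"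
| lam_rho_disjoint: "distinct [i, j, k, l] \<Longrightarrow> comm_word (Lam i j, True) (Rho k l, True) \<in> saut_words"
| lam_lam_target: "distinct [i, j, k] \<Longrightarrow> comm_word (Lam i j, True) (Lam k j, True) \<in> saut_words"
| rho_rho_target: "distinct [i, j, k] \<Longrightarrow> comm_word (Rho i j, True) (Rho k j, True) \<in> saut_words"
| lam_rho_source: "distinct [i, j, k] \<Longrightarrow> comm_word (Lam i j, True) (Rho i k, True) \<in> saut_words"
| lam_rho_target: "distinct [i, j, k] \<Longrightarrow> comm_word (Lam i j, True) (Rho k j, True) \<in> saut_words"
| lam_by_lam: "distinct [i, j, k] \<Longrightarrow> (Lam i k, b) # comm_word (Lam j k, b) (Lam i j, False) \<in> saut_words"
| rho_by_rho: "distinct [i, j, k] \<Longrightarrow> (Rho i k, b) # comm_word (Rho j k, b) (Rho i j, False) \<in> saut_words"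
| lam_by_rho: "distinct [i, j, k] \<Longrightarrow> (Lam i k, b) # comm_word (Rho j k, \<not> b) (Lam i j, True) \<in> saut_words"
| rho_by_lam: "distinct [i, j, k] \<Longrightarrow> (Rho i k, b) # comm_word (Lam j k, \<not> b) (Rho i j, True) \<in> saut_words"

lemma saut_rels_eq: "saut_rels n = {r \<in> saut_words. word_ix saut_ix r \<subseteq> {..<n}}"
proof -
  let ?F = "free_group (saut_gens n)"
  note eval = free_group_commutator_letters free_group_inv_letter free_group_int_pow_gen
  have gens: "Lam i j \<in> saut_gens n" "Rho i j \<in> saut_gens n" if "i \<noteq> j" "i < n" "j < n" for i j
    using that by (auto simp: saut_gens_iff)
  have lam_rho: "{commutator ?F (gen (Lam i j)) (gen (Rho i j)) | i j.
      {i, j} \<subseteq> {..<n} \<and> distinct [i, j]}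
    = {r. (\<exists>i j. r = comm_word (Lam i j, True) (Rho i j, True)
        \<and> distinct [i, j]) \<and> word_ix saut_ix r \<subseteq> {..<n}}"
    by (rule indexed_words2) (auto simp: eval gens free_group_mult cancels_def word_ix_def)
  have lam_lam: "{commutator ?F (gen (Lam i j)) (gen (Lam k l)) | i j k l.
      {i, j, k, l} \<subseteq> {..<n} \<and> distinct [i, j, k, l]}
    = {r. (\<exists>i j k l. r = comm_word (Lam i j, True) (Lam k l, True)
        \<and> distinct [i, j, k, l]) \<and> word_ix saut_ix r \<subseteq> {..<n}}"
    by (rule indexed_words4) (auto simp: eval gens free_group_mult cancels_def word_ix_def)
  have rho_rho: "{commutator ?F (gen (Rho i j)) (gen (Rho k l)) | i j k l.
      {i, j, k, l} \<subseteq> {..<n} \<and> distinct [i, j, k, l]}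
    = {r. (\<exists>i j k l. r = comm_word (Rho i j, True) (Rho k l, True)
        \<and> distinct [i, j, k, l]) \<and> word_ix saut_ix r \<subseteq> {..<n}}"
    by (rule indexed_words4) (auto simp: eval gens free_group_mult cancels_def word_ix_def)
  have lam_rho_disjoint: "{commutator ?F (gen (Lam i j)) (gen (Rho k l)) | i j k l.
      {i, j, k, l} \<subseteq> {..<n} \<and> distinct [i, j, k, l]}
    = {r. (\<exists>i j k l. r = comm_word (Lam i j, True) (Rho k l, True)
        \<and> distinct [i, j, k, l]) \<and> word_ix saut_ix r \<subseteq> {..<n}}"
    by (rule indexed_words4) (auto simp: eval gens free_group_mult cancels_def word_ix_def)
  have lam_lam_target: "{commutator ?F (gen (Lam i j)) (gen (Lam k j)) | i j k.
      {i, j, k} \<subseteq> {..<n} \<and> distinct [i, j, k]}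
    = {r. (\<exists>i j k. r = comm_word (Lam i j, True) (Lam k j, True)
        \<and> distinct [i, j, k]) \<and> word_ix saut_ix r \<subseteq> {..<n}}"
    by (rule indexed_words3) (auto simp: eval gens free_group_mult cancels_def word_ix_def)
  have rho_rho_target: "{commutator ?F (gen (Rho i j)) (gen (Rho k j)) | i j k.
      {i, j, k} \<subseteq> {..<n} \<and> distinct [i, j, k]}
    = {r. (\<exists>i j k. r = comm_word (Rho i j, True) (Rho k j, True)
        \<and> distinct [i, j, k]) \<and> word_ix saut_ix r \<subseteq> {..<n}}"
    by (rule indexed_words3) (auto simp: eval gens free_group_mult cancels_def word_ix_def)
  have lam_rho_source: "{commutator ?F (gen (Lam i j)) (gen (Rho i k)) | i j k.
      {i, j, k} \<subseteq> {..<n} \<and> distinct [i, j, k]}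
    = {r. (\<exists>i j k. r = comm_word (Lam i j, True) (Rho i k, True)
        \<and> distinct [i, j, k]) \<and> word_ix saut_ix r \<subseteq> {..<n}}"
    by (rule indexed_words3) (auto simp: eval gens free_group_mult cancels_def word_ix_def)
  have lam_rho_target: "{commutator ?F (gen (Lam i j)) (gen (Rho k j)) | i j k.
      {i, j, k} \<subseteq> {..<n} \<and> distinct [i, j, k]}
    = {r. (\<exists>i j k. r = comm_word (Lam i j, True) (Rho k j, True)
        \<and> distinct [i, j, k]) \<and> word_ix saut_ix r \<subseteq> {..<n}}"
    by (rule indexed_words3) (auto simp: eval gens free_group_mult cancels_def word_ix_def)
  have lam_by_lam: "{gen (Lam i k) [^]\<^bsub>?F\<^esub> e \<otimes>\<^bsub>?F\<^esub> commutator ?F (gen (Lam j k) [^]\<^bsub>?F\<^esub> e) (inv\<^bsub>?F\<^esub> gen (Lam i j)) | i j k (e :: int).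
      {i, j, k} \<subseteq> {..<n} \<and> distinct [i, j, k] \<and> e \<in> {1, -1}}
    = {r. (\<exists>i j k b. r = (Lam i k, b) # comm_word (Lam j k, b) (Lam i j, False)
        \<and> distinct [i, j, k]) \<and> word_ix saut_ix r \<subseteq> {..<n}}"
    by (rule indexed_words_sign) (auto simp: eval gens free_group_mult cancels_def word_ix_def)
  have rho_by_rho: "{gen (Rho i k) [^]\<^bsub>?F\<^esub> e \<otimes>\<^bsub>?F\<^esub> commutator ?F (gen (Rho j k) [^]\<^bsub>?F\<^esub> e) (inv\<^bsub>?F\<^esub> gen (Rho i j)) | i j k (e :: int).
      {i, j, k} \<subseteq> {..<n} \<and> distinct [i, j, k] \<and> e \<in> {1, -1}}
    = {r. (\<exists>i j k b. r = (Rho i k, b) # comm_word (Rho j k, b) (Rho i j, False)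
        \<and> distinct [i, j, k]) \<and> word_ix saut_ix r \<subseteq> {..<n}}"
    by (rule indexed_words_sign) (auto simp: eval gens free_group_mult cancels_def word_ix_def)
  have lam_by_rho: "{gen (Lam i k) [^]\<^bsub>?F\<^esub> e \<otimes>\<^bsub>?F\<^esub> commutator ?F (gen (Rho j k) [^]\<^bsub>?F\<^esub> (- e)) (gen (Lam i j)) | i j k (e :: int).
      {i, j, k} \<subseteq> {..<n} \<and> distinct [i, j, k] \<and> e \<in> {1, -1}}
    = {r. (\<exists>i j k b. r = (Lam i k, b) # comm_word (Rho j k, \<not> b) (Lam i j, True)
        \<and> distinct [i, j, k]) \<and> word_ix saut_ix r \<subseteq> {..<n}}"
    by (rule indexed_words_sign) (auto simp: eval gens free_group_mult cancels_def word_ix_def)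
  have rho_by_lam: "{gen (Rho i k) [^]\<^bsub>?F\<^esub> e \<otimes>\<^bsub>?F\<^esub> commutator ?F (gen (Lam j k) [^]\<^bsub>?F\<^esub> (- e)) (gen (Rho i j)) | i j k (e :: int).
      {i, j, k} \<subseteq> {..<n} \<and> distinct [i, j, k] \<and> e \<in> {1, -1}}
    = {r. (\<exists>i j k b. r = (Rho i k, b) # comm_word (Lam j k, \<not> b) (Rho i j, True)
        \<and> distinct [i, j, k]) \<and> word_ix saut_ix r \<subseteq> {..<n}}"
    by (rule indexed_words_sign) (auto simp: eval gens free_group_mult cancels_def word_ix_def)
  show ?thesis
    unfolding saut_rels_def Let_def lam_rho lam_lam rho_rho lam_rho_disjoint lam_lam_target
      rho_rho_target lam_rho_source lam_rho_target lam_by_lam rho_by_rho lam_by_rho rho_by_lam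
    by (rule Set.set_eqI) (simp only: Un_iff mem_Collect_eq saut_words.simps conj_disj_distribR disj_assoc)
qed

lemma saut_act_words:
  assumes "r \<in> saut_words" "inj_on f (word_ix saut_ix r)"
  shows "relabel (saut_act f) r \<in> saut_words"
  using assms
proof (cases rule: saut_words.cases)
  case (lam_rho i j)
  then have "inj_on f {i, j}"
    using assms(2) by (simp add: word_ix_def insert_commute)
  then have "distinct [f i, f j]" using lam_rho(2) by (auto simp: inj_on_def)
  from saut_words.lam_rho[OF this] show ?thesis by (simp add: lam_rho(1))
next
  case (lam_lam i j k l)
  then have "inj_on f {i, j, k, l}"
    using assms(2) by (simp add: word_ix_def insert_commute)
  then have "distinct [f i, f j, f k, f l]" using lam_lam(2) by (auto simp: inj_on_def)
  from saut_words.lam_lam[OF this] show ?thesis by (simp add: lam_lam(1))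
next
  case (rho_rho i j k l)
  then have "inj_on f {i, j, k, l}"
    using assms(2) by (simp add: word_ix_def insert_commute)
  then have "distinct [f i, f j, f k, f l]" using rho_rho(2) by (auto simp: inj_on_def)
  from saut_words.rho_rho[OF this] show ?thesis by (simp add: rho_rho(1))
next
  case (lam_rho_disjoint i j k l)
  then have "inj_on f {i, j, k, l}"
    using assms(2) by (simp add: word_ix_def insert_commute)
  then have "distinct [f i, f j, f k, f l]" using lam_rho_disjoint(2) by (auto simp: inj_on_def)
  from saut_words.lam_rho_disjoint[OF this] show ?thesis by (simp add: lam_rho_disjoint(1))
next
  case (lam_lam_target i j k)
  then have "inj_on f {i, j, k}"
    using assms(2) by (simp add: word_ix_def insert_commute)
  then have "distinct [f i, f j, f k]" using lam_lam_target(2) by (auto simp: inj_on_def)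
  from saut_words.lam_lam_target[OF this] show ?thesis by (simp add: lam_lam_target(1))
next
  case (rho_rho_target i j k)
  then have "inj_on f {i, j, k}"
    using assms(2) by (simp add: word_ix_def insert_commute)
  then have "distinct [f i, f j, f k]" using rho_rho_target(2) by (auto simp: inj_on_def)
  from saut_words.rho_rho_target[OF this] show ?thesis by (simp add: rho_rho_target(1))
next
  case (lam_rho_source i j k)
  then have "inj_on f {i, j, k}"
    using assms(2) by (simp add: word_ix_def insert_commute)
  then have "distinct [f i, f j, f k]" using lam_rho_source(2) by (auto simp: inj_on_def)
  from saut_words.lam_rho_source[OF this] show ?thesis by (simp add: lam_rho_source(1))
next
  case (lam_rho_target i j k)
  then have "inj_on f {i, j, k}"
    using assms(2) by (simp add: word_ix_def insert_commute)
  then have "distinct [f i, f j, f k]" using lam_rho_target(2) by (auto simp: inj_on_def)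
  from saut_words.lam_rho_target[OF this] show ?thesis by (simp add: lam_rho_target(1))
next
  case (lam_by_lam i j k b)
  then have "inj_on f {i, j, k}"
    using assms(2) by (simp add: word_ix_def insert_commute)
  then have "distinct [f i, f j, f k]" using lam_by_lam(2) by (auto simp: inj_on_def)
  from saut_words.lam_by_lam[OF this] show ?thesis by (simp add: lam_by_lam(1))
next
  case (rho_by_rho i j k b)
  then have "inj_on f {i, j, k}"
    using assms(2) by (simp add: word_ix_def insert_commute)
  then have "distinct [f i, f j, f k]" using rho_by_rho(2) by (auto simp: inj_on_def)
  from saut_words.rho_by_rho[OF this] show ?thesis by (simp add: rho_by_rho(1))
next
  case (lam_by_rho i j k b)
  then have "inj_on f {i, j, k}"
    using assms(2) by (simp add: word_ix_def insert_commute)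
  then have "distinct [f i, f j, f k]" using lam_by_rho(2) by (auto simp: inj_on_def)
  from saut_words.lam_by_rho[OF this] show ?thesis by (simp add: lam_by_rho(1))
next
  case (rho_by_lam i j k b)
  then have "inj_on f {i, j, k}"
    using assms(2) by (simp add: word_ix_def insert_commute)
  then have "distinct [f i, f j, f k]" using rho_by_lam(2) by (auto simp: inj_on_def)
  from saut_words.rho_by_lam[OF this] show ?thesis by (simp add: rho_by_lam(1))
qed

interpretation saut: index_family SAut saut_gens saut_ev saut_ix saut_rels
  "{Lam i j | i j. i \<noteq> j} \<union> {Rho i j | i j. i \<noteq> j}" saut_words saut_act emb_aut
proof (rule index_family.intro)
  let ?A = "{Lam i j | i j. i \<noteq> j} \<union> {Rho i j | i j. i \<noteq> j}"
  show "group (SAut n)" for n by (rule group_SAut)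
  show "finite (saut_rels n)" for n by (rule finite_saut_rels)
  show "saut_rels n = {r \<in> saut_words. word_ix saut_ix r \<subseteq> {..<n}}" for n by (rule saut_rels_eq)
  show "finite (saut_gens n)" for n by (simp add: saut_gens_def)
  show "saut_gens n = {s \<in> ?A. saut_ix s \<subseteq> {..<n}}" for n
    by (auto simp: saut_gens_iff)
  show "saut_ev n \<in> saut_gens n \<rightarrow> carrier (SAut n)" for n by (simp add: saut_ev_carrier)
  show "card (saut_ix s) = 2" if "s \<in> ?A" for s using that by auto
  show "fst ` set r \<subseteq> ?A" if "r \<in> saut_words" for r
    using that by cases auto
  show "saut_ix (saut_act f s) = f ` saut_ix s" for f s by (cases s) simp_all
  show "saut_act f (saut_act g s) = saut_act (f \<circ> g) s" for f g s by (cases s) simp_all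
  show "saut_act f s = s" if "\<And>i. i \<in> saut_ix s \<Longrightarrow> f i = i" for f s
    using that by (cases s) simp_all
  show "saut_act f s \<in> ?A" if "s \<in> ?A" "inj_on f (saut_ix s)" for f s using that by auto
  show "relabel (saut_act f) r \<in> saut_words"
    if "r \<in> saut_words" "inj_on f (word_ix saut_ix r)" for f r
    by (rule saut_act_words[OF that])
  show "emb_aut n p \<in> hom (SAut n) (SAut (Suc n))" if "p \<le> n" for n p
    by (rule emb_aut_hom[OF that])
  show "saut_ev (Suc n) (saut_act (insert_index p) s) = emb_aut n p (saut_ev n s)"
    if "p \<le> n" "s \<in> saut_gens n" for n p s
    by (rule emb_aut_saut_ev[OF that])
qed

theorem theorem1p1:
  fixes m n :: nat and lam :: real
  assumes "m \<ge> 3" and "n \<ge> m"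
  shows
    "(sum_of_squares (SL m) (sl_gens m) (\<lambda>s t. sl_adj m s t - scalar_mat (SL m) lam s t) \<longrightarrow>
      sum_of_squares (SL n) (sl_gens n)
        (\<lambda>s t. sl_adj n s t - scalar_mat (SL n) ((real n - 2) / (real m - 2) * lam) s t)) \<and>
     (sum_of_squares (SAut m) (saut_gens m) (\<lambda>s t. saut_adj m s t - scalar_mat (SAut m) lam s t) \<longrightarrow>
      sum_of_squares (SAut n) (saut_gens n)
        (\<lambda>s t. saut_adj n s t - scalar_mat (SAut n) ((real n - 2) / (real m - 2) * lam) s t))"
  using sl.sum_of_squares_stable[OF assms] saut.sum_of_squares_stable[OF assms]
  unfolding sl_adj_def saut_adj_def by blast

end
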